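(* Let $d_1,d_2,d_{11},d_{22}\ge 0$ and $d_{12},d_{21}>0$ be constants. Let $\rho_1,\rho_2,\sigma_1,\sigma_2\in L^\infty(\mathbb{T})$ be non-negative kernels with $\rho_1(x)=\rho_2(-x)=\rho(x)$, $\sigma_1(x)=\sigma_1(-x)$, $\sigma_2(x)=\sigma_2(-x)$, and let $u_1^0,u_2^0\in L^1(\mathbb{T})$ be non-negative with $h_1(u_1^0),h_2(u_2^0)\in L^1(\mathbb{T})$. Then, for every $1\le k\le N_T$, there exists (at least) one nonnegative solution $(u_1^k,u_2^k)$ to the scheme (S) defined in the context, started from the discretized initial data. Moreover this solution satisfies: (i) Mass conservation: $\sum_{i\in\mathcal{I}}\Delta x\,u_{j,i}^k=\int_{\mathbb{T}}u_j^0(x)\,\mathrm{d}x$ for all $0\le k\le N_T$ and $j=1,2$. (ii) Entropy production estimate: for all $1\le k\le N_T$, $$H(u_1^k,u_2^k)+\Delta t\,D(u_1^k,u_2^k)\le H(u_1^{k-1},u_2^{k-1}).$$ Finally, for all $j\in\{1,2\}$, if $d_j$ is positive then $u_j^k$ is positive (i.e. $u_{j,i}^k>0$ for all $i\in\mathcal{I}$) for all $0<k\le N_T$.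
   Context: $\mathbb{T}=\mathbb{R}/\mathbb{Z}$. Let $N\ge1$ be an integer, $\Delta x=1/N$, $\mathcal{I}=\mathbb{Z}/N\mathbb{Z}$ (indices are taken modulo $N$), $x_i=i\Delta x$, and $K_i=((i-\frac12)\Delta x,(i+\frac12)\Delta x)\subset\mathbb{T}$. Let $T>0$, $N_T\ge1$ an integer and $\Delta t=T/N_T$. Scheme (S). The initial data are discretized by $u_{j,i}^0=\frac1{\Delta x}\int_{K_i}u_j^0(x)\,\mathrm{d}x$. For $k\ge1$, given $(u_1^{k-1},u_2^{k-1})\in\mathbb{R}^{2N}$, a solution $(u_1^k,u_2^k)\in\mathbb{R}^{2N}$ satisfies (reaction terms are taken to be zero) $$\frac{u_{j,i}^k-u_{j,i}^{k-1}}{\Delta t}-\frac{\mu_{j,i+1}^ku_{j,i+1}^k-2\mu_{j,i}^ku_{j,i}^k+\mu_{j,i-1}^ku_{j,i-1}^k}{\Delta x^2}=0,\qquad i\in\mathcal{I},\ j=1,2,$$ with $$\mu_{1,i}^k=d_1+d_{11}\sum_{n\in\mathcal{I}}\Delta x\,\sigma_{1,i-n}u_{1,n}^k+d_{12}\sum_{n\in\mathcal{I}}\Delta x\,\rho_{1,i-n}u_{2,n}^k,$$ $$\mu_{2,i}^k=d_2+d_{21}\sum_{n\in\mathcal{I}}\Delta x\,\rho_{2,i-n}u_{1,n}^k+d_{22}\sum_{n\in\mathcal{I}}\Delta x\,\sigma_{2,i-n}u_{2,n}^k,$$ where $\rho_{j,i}=\frac1{\Delta x}\int_{K_i}\rho_j(y)\,\mathrm{d}y$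 and $\sigma_{j,i}=\frac1{\Delta x}\int_{K_i}\sigma_j(y)\,\mathrm{d}y$. One writes $\rho_i=\rho_{1,i}=\rho_{2,-i}$. Entropy: $h_1(x)=\frac1{d_{12}}(x(\log x-1)+1)$, $h_2(x)=\frac1{d_{21}}(x(\log x-1)+1)$ for $x>0$, extended continuously at $x=0$, and $H(u_1,u_2)=\sum_{i\in\mathcal{I}}\Delta x\,h_1(u_{1,i})+\sum_{i\in\mathcal{I}}\Delta x\,h_2(u_{2,i})$. Dissipation, for componentwise nonnegative $u_1,u_2$: $$D(u_1,u_2)=2\frac{d_{11}}{d_{12}}\sum_{j\in\mathcal{I}}\sigma_{1,j}\sum_{i\in\mathcal{I}}\Big(\sqrt{u_{1,i+1}u_{1,i+1-j}}-\sqrt{u_{1,i}u_{1,i-j}}\Big)^2+2\frac{d_{22}}{d_{21}}\sum_{j\in\mathcal{I}}\sigma_{2,j}\sum_{i\in\mathcal{I}}\Big(\sqrt{u_{2,i+1}u_{2,i+1-j}}-\sqrt{u_{2,i}u_{2,i-j}}\Big)^2$$ $$+4\frac{d_1}{d_{12}}|\sqrt{u_1}|_{1,2}^2+4\frac{d_2}{d_{21}}|\sqrt{u_2}|_{1,2}^2+4\sum_{j\in\mathcal{I}}\rho_j\sum_{i\in\mathcal{I}}\Big(\sqrt{u_{1,i+1}u_{2,i+1-j}}-\sqrt{u_{1,i}u_{2,i-j}}\Big)^2,$$ where $|w|_{1,2}^2=\sum_{i\in\mathcal{I}}\Delta x\left|\frac{w_{i+1}-w_i}{\Delta x}\right|^2$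 and square roots of vectors are taken componentwise.
   Formalization: The final positivity claim for species j is stated only when the integral of u_j^0 over the torus is positive; if u_j^0 = 0 a.e., mass conservation and nonnegativity force u_j^k = 0, so the claim as written fails. *)

theory Defs
  imports "HOL-Analysis.Analysis"
begin

(* Functions on the torus R/Z are 1-periodic functions on the reals; elements of L^1 and L^infinity
   are given by representatives, so pointwise conditions on them are imposed almost everywhere. *)

definition torus_measurable :: "(real \<Rightarrow> real) \<Rightarrow> bool" where
  "torus_measurable f \<longleftrightarrow> (\<forall>x. f (x + 1) = f x) \<and> f \<in> borel_measurable lebesgue"

definition L1_torus :: "(real \<Rightarrow> real) \<Rightarrow> bool" where
  "L1_torus f \<longleftrightarrow> torus_measurable f \<and> set_integrable lebesgue {0..<1} f"

definition Linf_torus :: "(real \<Rightarrow> real) \<Rightarrow> bool" where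
  "Linf_torus f \<longleftrightarrow> torus_measurable f \<and> (\<exists>C. AE x in lebesgue. \<bar>f x\<bar> \<le> C)"

definition torus_integral :: "(real \<Rightarrow> real) \<Rightarrow> real" where
  "torus_integral f = (LINT x:{0..<1}|lebesgue. f x)"

(* Vectors indexed by Z/NZ are N-periodic functions on the integers; a sum over Z/NZ is a sum over
   the representatives {0..<int N}. *)

definition grid_periodic :: "nat \<Rightarrow> (int \<Rightarrow> real) \<Rightarrow> bool" where
  "grid_periodic N u \<longleftrightarrow> (\<forall>i. u (i + int N) = u i)"

definition dx :: "nat \<Rightarrow> real" where
  "dx N = 1 / real N"

definition cell :: "nat \<Rightarrow> int \<Rightarrow> real set" where
  "cell N i = {(of_int i - 1/2) * dx N <..< (of_int i + 1/2) * dx N}"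

definition cell_avg :: "nat \<Rightarrow> (real \<Rightarrow> real) \<Rightarrow> int \<Rightarrow> real" where
  "cell_avg N f i = 1 / dx N * (LINT x:cell N i|lebesgue. f x)"

definition grid_conv :: "nat \<Rightarrow> (int \<Rightarrow> real) \<Rightarrow> (int \<Rightarrow> real) \<Rightarrow> int \<Rightarrow> real" where
  "grid_conv N w u i = (\<Sum>n\<in>{0..<int N}. dx N * w (i - n) * u n)"

(* mu_j is obtained with v = u_j and w the other species. *)
definition diffusivity ::
  "nat \<Rightarrow> real \<Rightarrow> real \<Rightarrow> (real \<Rightarrow> real) \<Rightarrow> real \<Rightarrow> (real \<Rightarrow> real) \<Rightarrow>
   (int \<Rightarrow> real) \<Rightarrow> (int \<Rightarrow> real) \<Rightarrow> int \<Rightarrow> real" where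
  "diffusivity N d dself \<sigma> dcross \<rho> v w i =
     d + dself * grid_conv N (cell_avg N \<sigma>) v i + dcross * grid_conv N (cell_avg N \<rho>) w i"

definition scheme_eq ::
  "nat \<Rightarrow> real \<Rightarrow> (int \<Rightarrow> real) \<Rightarrow> (int \<Rightarrow> real) \<Rightarrow> (int \<Rightarrow> real) \<Rightarrow> bool" where
  "scheme_eq N dt \<mu> uprev u \<longleftrightarrow>
     (\<forall>i. (u i - uprev i) / dt
          - (\<mu> (i + 1) * u (i + 1) - 2 * \<mu> i * u i + \<mu> (i - 1) * u (i - 1)) / (dx N)\<^sup>2 = 0)"

(* h_1 and h_2 are the cases d = d12 and d = d21. At x = 0 the product vanishes, so the value there
   is 1/d, which is the continuous extension from x > 0. *)
definition entropy_density :: "real \<Rightarrow> real \<Rightarrow> real" where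
  "entropy_density d x = 1 / d * (x * (ln x - 1) + 1)"

definition entropy :: "nat \<Rightarrow> real \<Rightarrow> real \<Rightarrow> (int \<Rightarrow> real) \<Rightarrow> (int \<Rightarrow> real) \<Rightarrow> real" where
  "entropy N d12 d21 u1 u2 =
     (\<Sum>i\<in>{0..<int N}. dx N * entropy_density d12 (u1 i))
   + (\<Sum>i\<in>{0..<int N}. dx N * entropy_density d21 (u2 i))"

definition h1_seminorm_sq :: "nat \<Rightarrow> (int \<Rightarrow> real) \<Rightarrow> real" where
  "h1_seminorm_sq N w = (\<Sum>i\<in>{0..<int N}. dx N * \<bar>(w (i + 1) - w i) / dx N\<bar>\<^sup>2)"

definition pair_dissipation ::
  "nat \<Rightarrow> (int \<Rightarrow> real) \<Rightarrow> (int \<Rightarrow> real) \<Rightarrow> (int \<Rightarrow> real) \<Rightarrow> real" where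
  "pair_dissipation N w u v =
     (\<Sum>j\<in>{0..<int N}. w j *
        (\<Sum>i\<in>{0..<int N}. (sqrt (u (i + 1) * v (i + 1 - j)) - sqrt (u i * v (i - j)))\<^sup>2))"

definition dissipation ::
  "nat \<Rightarrow> real \<Rightarrow> real \<Rightarrow> real \<Rightarrow> real \<Rightarrow> real \<Rightarrow> real \<Rightarrow>
   (real \<Rightarrow> real) \<Rightarrow> (real \<Rightarrow> real) \<Rightarrow> (real \<Rightarrow> real) \<Rightarrow> (int \<Rightarrow> real) \<Rightarrow> (int \<Rightarrow> real) \<Rightarrow> real" where
  "dissipation N d1 d2 d11 d12 d21 d22 \<sigma>1 \<sigma>2 \<rho> u1 u2 =
     2 * (d11 / d12) * pair_dissipation N (cell_avg N \<sigma>1) u1 u1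
   + 2 * (d22 / d21) * pair_dissipation N (cell_avg N \<sigma>2) u2 u2
   + 4 * (d1 / d12) * h1_seminorm_sq N (\<lambda>i. sqrt (u1 i))
   + 4 * (d2 / d21) * h1_seminorm_sq N (\<lambda>i. sqrt (u2 i))
   + 4 * pair_dissipation N (cell_avg N \<rho>) u1 u2"

end

theory Submission
  imports Defs
begin

text \<open>
  One time step asks for nonnegative grid functions with \<open>u - p = dt * Lap (\<mu> u)\<close>, where the
  diffusivities \<open>\<mu>\<close> depend on the unknowns. A solution is a fixed point of the relaxed explicit
  map \<open>u \<mapsto> u + \<tau> (p - u + dt * Lap (\<mu> u))\<close>. On a compact box the diffusivities are bounded, so for
  small \<open>\<tau>\<close> this map keeps nonnegative vectors nonnegative, and cutting it off at an upper bound
  \<open>B\<close> not smaller than the mass of \<open>p\<close> makes it a continuous self-map of the box. At a fixed point of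
  the truncated map every residual \<open>p - u + dt * Lap (\<mu> u)\<close> is nonnegative, and the residuals of a
  species sum to the mass of \<open>p\<close> minus that of \<open>u\<close>; a component with a positive residual would equal
  \<open>B\<close>, which leaves no mass for that sum to be positive. Hence the residuals vanish
  (\<open>implicit_step_exists\<close>). The fixed point comes from Brouwer's theorem in the form of Tychonoff's
  theorem for the Hilbert cube (\<open>hilbert_cube_fixpoint\<close>), which is indexed by the natural numbers
  and so does not tie the number of cells to a type.

  For the entropy estimate the equation of each species is tested with the logarithm of the
  solution. Convexity bounds the entropy difference from above, summation by parts moves a difference
  onto the logarithm, and by the symmetries of the kernels the nonlocal terms of the two species
  combine into sums of \<open>(a - b) (ln a - ln b)\<close>, which is at least \<open>4 (sqrt a - sqrt b)^2\<close>
  (\<open>pair_dissipation_le_log_pairing\<close>). No regularization is needed for vanishing components: where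
  \<open>u\<close> is zero, the scheme forces \<open>p\<close> and the products \<open>\<mu> u\<close> in the neighbouring cells to be zero
  (\<open>scheme_eq_zero\<close>), so every term that contains the logarithm of zero has the factor zero. The same
  observation gives positivity: if \<open>\<mu>\<close> is positive, one zero spreads to all cells, which
  contradicts a positive mass.
\<close>

section \<open>A fixed point theorem for the Hilbert cube\<close>

lemma tendsto_fun_iff:
  fixes f :: "'a \<Rightarrow> 'b \<Rightarrow> 'c::topological_space"
  shows "(f \<longlongrightarrow> l) F \<longleftrightarrow> (\<forall>i. ((\<lambda>x. f x i) \<longlongrightarrow> l i) F)"
proof -
  have "limitin (product_topology (\<lambda>i. euclidean) UNIV) f l F \<longleftrightarrow>
      (\<forall>i. limitin euclidean (\<lambda>x. f x i) (l i) F)"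
    by (subst limitin_componentwise) auto
  then show ?thesis
    by (simp add: euclidean_product_topology)
qed

lemma compact_hilbert_cube: "compact {x :: nat \<Rightarrow> real. \<forall>i. 0 \<le> x i \<and> x i \<le> 1}"
proof -
  have "compactin (product_topology (\<lambda>i::nat. euclidean) UNIV) (PiE UNIV (\<lambda>i. {0..1::real}))"
    by (subst compactin_PiE) auto
  moreover have "PiE UNIV (\<lambda>i. {0..1::real}) = {x :: nat \<Rightarrow> real. \<forall>i. 0 \<le> x i \<and> x i \<le> 1}"
    by (auto simp: PiE_iff)
  ultimately show ?thesis
    by (simp add: euclidean_product_topology)
qed

text \<open>
  Kuhn's lemma is applied to the first \<open>p\<close> coordinates on the grid of mesh \<open>1 / p\<close>, the remaining
  coordinates being zero. It yields a point such that, for each of these coordinates, the displacement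
  \<open>f y - y\<close> takes both weak signs within distance \<open>1 / p\<close>.
\<close>

lemma hilbert_cube_approximate_fixpoint:
  fixes f :: "(nat \<Rightarrow> real) \<Rightarrow> nat \<Rightarrow> real" and p :: nat
  defines "S \<equiv> {x :: nat \<Rightarrow> real. \<forall>i. 0 \<le> x i \<and> x i \<le> 1}"
  assumes maps: "f ` S \<subseteq> S" and p: "0 < p"
  shows "\<exists>x\<in>S. \<forall>i<p. \<exists>a\<in>S. \<exists>b\<in>S.
           (\<forall>j. \<bar>a j - x j\<bar> \<le> 1 / real p \<and> \<bar>b j - x j\<bar> \<le> 1 / real p) \<and> a i \<le> f a i \<and> f b i \<le> b i"
proof -
  have "\<exists>l. (\<forall>x i. l x i \<le> (1::nat)) \<and>
      (\<forall>x i. x \<in> S \<and> True \<and> x i = 0 \<longrightarrow> l x i = 0) \<and>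
      (\<forall>x i. x \<in> S \<and> True \<and> x i = 1 \<longrightarrow> l x i = 1) \<and>
      (\<forall>x i. x \<in> S \<and> True \<and> l x i = 0 \<longrightarrow> x i \<le> f x i) \<and>
      (\<forall>x i. x \<in> S \<and> True \<and> l x i = 1 \<longrightarrow> f x i \<le> x i)"
    using maps by (intro kuhn_labelling_lemma') (auto simp: S_def)
  then obtain l :: "(nat \<Rightarrow> real) \<Rightarrow> nat \<Rightarrow> nat" where l:
      "(\<forall>x i. l x i \<le> (1::nat)) \<and>
      (\<forall>x i. x \<in> S \<and> True \<and> x i = 0 \<longrightarrow> l x i = 0) \<and>
      (\<forall>x i. x \<in> S \<and> True \<and> x i = 1 \<longrightarrow> l x i = 1) \<and>
      (\<forall>x i. x \<in> S \<and> True \<and> l x i = 0 \<longrightarrow> x i \<le> f x i) \<and>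
      (\<forall>x i. x \<in> S \<and> True \<and> l x i = 1 \<longrightarrow> f x i \<le> x i)"
    by - (erule exE, erule that)
  have l_le: "l x i \<le> 1" for x i using l by (elim conjE) simp
  have l0: "l x i = 0" if "x \<in> S" "x i = 0" for x i using l that by (elim conjE) simp
  have l1: "l x i = 1" if "x \<in> S" "x i = 1" for x i using l that by (elim conjE) simp
  have up: "x i \<le> f x i" if "x \<in> S" "l x i = 0" for x i using l that by (elim conjE) simp
  have dn: "f x i \<le> x i" if "x \<in> S" "l x i = 1" for x i using l that by (elim conjE) simp
  define g :: "(nat \<Rightarrow> nat) \<Rightarrow> nat \<Rightarrow> real" where "g r i = (if i < p then real (r i) / real p else 0)" for r i
  have gS: "g r \<in> S" if "\<forall>i<p. r i \<le> p" for r
    using that by (auto simp: g_def S_def)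
  obtain q where q: "\<forall>i<p. q i < p"
    and rs: "\<forall>i<p. \<exists>r s. (\<forall>j<p. q j \<le> r j \<and> r j \<le> q j + 1) \<and> (\<forall>j<p. q j \<le> s j \<and> s j \<le> q j + 1)
          \<and> l (g r) i \<noteq> l (g s) i"
  proof (rule kuhn_lemma[of p p "\<lambda>r. l (g r)"])
    show "\<forall>x. (\<forall>i<p. x i \<le> p) \<longrightarrow> (\<forall>i<p. l (g x) i = 0 \<or> l (g x) i = 1)"
    proof (intro allI impI)
      show "l (g x) i = 0 \<or> l (g x) i = 1" for x i
        using l_le[of "g x" i] by linarith
    qed
    show "\<forall>x. (\<forall>i<p. x i \<le> p) \<longrightarrow> (\<forall>i<p. x i = 0 \<longrightarrow> l (g x) i = 0)"
      using l0[OF gS] by (simp add: g_def)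
    show "\<forall>x. (\<forall>i<p. x i \<le> p) \<longrightarrow> (\<forall>i<p. x i = p \<longrightarrow> l (g x) i = 1)"
      using l1[OF gS] p by (simp add: g_def)
  qed (use p in auto)
  have close: "\<bar>g r j - g q j\<bar> \<le> 1 / real p" if "\<forall>j<p. q j \<le> r j \<and> r j \<le> q j + 1" for r j
  proof (cases "j < p")
    case True
    then have "real (q j) \<le> real (r j)" "real (r j) \<le> real (q j) + 1"
      using that by (auto simp flip: of_nat_Suc)
    then show ?thesis
      using True p by (simp add: g_def flip: diff_divide_distrib) (simp add: divide_right_mono)
  qed (use p in \<open>simp add: g_def\<close>)
  have rS: "g r \<in> S" if "\<forall>j<p. q j \<le> r j \<and> r j \<le> q j + 1" for r
  proof (rule gS, intro allI impI)
    fix i assume "i < p"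
    then have "r i \<le> q i + 1" "q i < p" using that q by auto
    then show "r i \<le> p" by simp
  qed
  show ?thesis
  proof (rule bexI[of _ "g q"], intro allI impI)
    fix i assume "i < p"
    with rs obtain r s where r: "\<forall>j<p. q j \<le> r j \<and> r j \<le> q j + 1"
      and s: "\<forall>j<p. q j \<le> s j \<and> s j \<le> q j + 1" and ne: "l (g r) i \<noteq> l (g s) i"
      by blast
    have "l (g r) i = 0 \<and> l (g s) i = 1 \<or> l (g s) i = 0 \<and> l (g r) i = 1"
      using ne l_le[of "g r" i] l_le[of "g s" i] by linarith
    then show "\<exists>a\<in>S. \<exists>b\<in>S. (\<forall>j. \<bar>a j - g q j\<bar> \<le> 1 / real p \<and> \<bar>b j - g q j\<bar> \<le> 1 / real p)
         \<and> a i \<le> f a i \<and> f b i \<le> b i" (is ?ab)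
    proof
      assume "l (g r) i = 0 \<and> l (g s) i = 1"
      then show ?ab
        using close[OF r] close[OF s] up[OF rS[OF r]] dn[OF rS[OF s]] rS[OF r] rS[OF s]
        by - (rule bexI[where x="g r"], rule bexI[where x="g s"], simp_all)
    next
      assume "l (g s) i = 0 \<and> l (g r) i = 1"
      then show ?ab
        using close[OF r] close[OF s] up[OF rS[OF s]] dn[OF rS[OF r]] rS[OF r] rS[OF s]
        by - (rule bexI[where x="g s"], rule bexI[where x="g r"], simp_all)
    qed
  next
    show "g q \<in> S" using gS q by (simp add: less_imp_le)
  qed
qed

text \<open>
  In a limit point of the approximate fixed points each coordinate of the displacement is both
  nonnegative and nonpositive.
\<close>

theorem hilbert_cube_fixpoint:
  fixes f :: "(nat \<Rightarrow> real) \<Rightarrow> nat \<Rightarrow> real"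
  defines "S \<equiv> {x :: nat \<Rightarrow> real. \<forall>i. 0 \<le> x i \<and> x i \<le> 1}"
  assumes cont: "continuous_on S f" and maps: "f ` S \<subseteq> S"
  shows "\<exists>x\<in>S. f x = x"
proof -
  define P where "P k x a b \<longleftrightarrow> x \<in> S \<and> (\<forall>i<Suc k. a i \<in> S \<and> b i \<in> S \<and>
          (\<forall>j. \<bar>a i j - x j\<bar> \<le> 1 / real (Suc k) \<and> \<bar>b i j - x j\<bar> \<le> 1 / real (Suc k)) \<and>
          a i i \<le> f (a i) i \<and> f (b i) i \<le> b i i)" for k x a b
  have "\<forall>k. \<exists>x a b. P k x a b"
  proof
    fix k
    from hilbert_cube_approximate_fixpoint[OF maps[unfolded S_def], of "Suc k"]
    obtain x where x: "x \<in> S" and *: "\<forall>i<Suc k. \<exists>a\<in>S. \<exists>b\<in>S.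
       (\<forall>j. \<bar>a j - x j\<bar> \<le> 1 / real (Suc k) \<and> \<bar>b j - x j\<bar> \<le> 1 / real (Suc k)) \<and> a i \<le> f a i \<and> f b i \<le> b i"
      unfolding S_def by blast
    then obtain a where a: "\<forall>i<Suc k. a i \<in> S \<and> (\<exists>b\<in>S.
       (\<forall>j. \<bar>a i j - x j\<bar> \<le> 1 / real (Suc k) \<and> \<bar>b j - x j\<bar> \<le> 1 / real (Suc k)) \<and> a i i \<le> f (a i) i \<and> f b i \<le> b i)"
      by metis
    then obtain b where b: "\<forall>i<Suc k. b i \<in> S \<and>
       (\<forall>j. \<bar>a i j - x j\<bar> \<le> 1 / real (Suc k) \<and> \<bar>b i j - x j\<bar> \<le> 1 / real (Suc k)) \<and> a i i \<le> f (a i) i \<and> f (b i) i \<le> b i i"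
      by metis
    show "\<exists>x a b. P k x a b"
    proof (intro exI)
      have "\<forall>i<Suc k. a i \<in> S" using a by blast
      then show "P k x a b"
        unfolding P_def using x b by simp
    qed
  qed
  then obtain x a b where P: "P k (x k) (a k) (b k)" for k
    by metis
  have xS: "x k \<in> S" for k
    using P unfolding P_def by blast
  have ab: "a k i \<in> S \<and> b k i \<in> S \<and>
          (\<forall>j. \<bar>a k i j - x k j\<bar> \<le> 1 / real (Suc k) \<and> \<bar>b k i j - x k j\<bar> \<le> 1 / real (Suc k)) \<and>
          a k i i \<le> f (a k i) i \<and> f (b k i) i \<le> b k i i" if "i < Suc k" for k i
    using P that unfolding P_def by blast
  have "seq_compact S"
    unfolding S_def by (intro compact_imp_seq_compact compact_hilbert_cube)
  then obtain z \<phi> where z: "z \<in> S" and \<phi>: "strict_mono \<phi>" and lim: "(x \<circ> \<phi>) \<longlonglongrightarrow> z"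
    using xS unfolding seq_compact_def by blast
  have fz: "f z i = z i" for i
  proof -
    have ev: "\<forall>\<^sub>F k in sequentially. i < Suc (\<phi> k)"
      using eventually_ge_at_top[of i]
      by eventually_elim (use seq_suble[OF \<phi>] in \<open>simp add: le_trans less_Suc_eq_le\<close>)
    have inv: "(\<lambda>k. 1 / real (Suc (\<phi> k))) \<longlonglongrightarrow> 0"
      using LIMSEQ_subseq_LIMSEQ[OF LIMSEQ_inverse_real_of_nat \<phi>] by (simp add: o_def inverse_eq_divide)
    have conv: "(\<lambda>k. f (c (\<phi> k)) i - c (\<phi> k) i) \<longlonglongrightarrow> f z i - z i"
      if c: "\<And>k. i < Suc k \<Longrightarrow> c k \<in> S \<and> (\<forall>j. \<bar>c k j - x k j\<bar> \<le> 1 / real (Suc k))" for c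
    proof -
      have "(\<lambda>k. c (\<phi> k) j) \<longlonglongrightarrow> z j" for j
      proof -
        have "(\<lambda>k. c (\<phi> k) j - x (\<phi> k) j) \<longlonglongrightarrow> 0"
          by (rule Lim_null_comparison[OF _ inv])
             (use ev in \<open>eventually_elim, use c in auto\<close>)
        moreover have "(\<lambda>k. x (\<phi> k) j) \<longlonglongrightarrow> z j"
          using lim by (simp add: tendsto_fun_iff o_def)
        ultimately show ?thesis
          using tendsto_add by fastforce
      qed
      then have cz: "(\<lambda>k. c (\<phi> k)) \<longlonglongrightarrow> z"
        by (simp add: tendsto_fun_iff)
      moreover have "\<forall>\<^sub>F k in sequentially. c (\<phi> k) \<in> S"
        using ev by eventually_elim (use c in auto)
      ultimately have "(\<lambda>k. f (c (\<phi> k))) \<longlonglongrightarrow> f z"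
        by (rule continuous_on_tendsto_compose[OF cont _ z])
      then show ?thesis
        using cz by (intro tendsto_diff) (simp_all add: tendsto_fun_iff)
    qed
    have "0 \<le> f z i - z i"
      by (rule tendsto_lowerbound[OF conv[of "\<lambda>k. a k i"]])
         (use ab ev in \<open>auto elim!: eventually_mono\<close>)
    moreover have "f z i - z i \<le> 0"
      by (rule tendsto_upperbound[OF conv[of "\<lambda>k. b k i"]])
         (use ab ev in \<open>auto elim!: eventually_mono\<close>)
    ultimately show ?thesis by simp
  qed
  show ?thesis
    using z fz by blast
qed

section \<open>Periodic functions on the grid\<close>

lemma grid_periodic_add: "grid_periodic N f \<Longrightarrow> f (i + int N) = f i"
  by (simp add: grid_periodic_def)

lemma grid_periodic_add_mult:
  assumes "grid_periodic N f"
  shows "f (i + int N * k) = f i"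
proof (induction k rule: int_induct[of _ 0])
  case (step1 k)
  then show ?case
    using grid_periodic_add[OF assms, of "i + int N * k"] by (simp add: algebra_simps)
next
  case (step2 k)
  then show ?case
    using grid_periodic_add[OF assms, of "i + int N * (k - 1)"] by (simp add: algebra_simps)
qed simp

lemma grid_periodic_mod:
  assumes "grid_periodic N f"
  shows "f (i mod int N) = f i"
  using grid_periodic_add_mult[OF assms, of "i mod int N" "i div int N"] by (simp add: add.commute)

lemma grid_periodic_mod_eq:
  assumes "grid_periodic N f" "i mod int N = j mod int N"
  shows "f i = f j"
  by (metis assms grid_periodic_mod)

lemma sum_grid_shift:
  assumes N: "N \<ge> 1" and f: "grid_periodic N f"
  shows "(\<Sum>i\<in>{0..<int N}. f (i + c)) = (\<Sum>i\<in>{0..<int N}. f i)"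
proof (rule sum.reindex_bij_witness[of _ "\<lambda>i. (i - c) mod int N" "\<lambda>i. (i + c) mod int N"])
  fix i assume "i \<in> {0..<int N}"
  then show "((i + c) mod int N - c) mod int N = i" "((i - c) mod int N + c) mod int N = i"
    by (simp_all add: mod_diff_left_eq mod_add_left_eq)
  show "f ((i + c) mod int N) = f (i + c)" by (rule grid_periodic_mod[OF f])
qed (use N in auto)

lemma sum_grid_reflect:
  assumes N: "N \<ge> 1" and f: "grid_periodic N f"
  shows "(\<Sum>i\<in>{0..<int N}. f (c - i)) = (\<Sum>i\<in>{0..<int N}. f i)"
proof (rule sum.reindex_bij_witness[of _ "\<lambda>i. (c - i) mod int N" "\<lambda>i. (c - i) mod int N"])
  fix i assume "i \<in> {0..<int N}"
  then show "(c - (c - i) mod int N) mod int N = i" "(c - (c - i) mod int N) mod int N = i"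
    by (simp_all add: mod_diff_right_eq)
  show "f ((c - i) mod int N) = f (c - i)" by (rule grid_periodic_mod[OF f])
qed (use N in auto)

lemma sum_grid_laplacian:
  fixes f :: "int \<Rightarrow> real"
  assumes N: "N \<ge> 1" and f: "grid_periodic N f"
  shows "(\<Sum>i\<in>{0..<int N}. f (i + 1) - 2 * f i + f (i - 1)) = 0"
  using sum_grid_shift[OF N f, of 1] sum_grid_shift[OF N f, of "-1"]
  by (simp add: sum.distrib sum_subtractf flip: sum_distrib_left)

section \<open>Solvability of the implicit step\<close>

lemma scheme_eq_iff:
  assumes "dt > 0"
  shows "scheme_eq N dt \<mu> p u \<longleftrightarrow>
    (\<forall>i. p i - u i + dt / (dx N)\<^sup>2 * (\<mu> (i+1) * u (i+1) - 2 * (\<mu> i * u i) + \<mu> (i-1) * u (i-1)) = 0)"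
  unfolding scheme_eq_def using assms by (intro all_cong1) (auto simp: field_simps)

text \<open>
  Existence for a system of \<open>n\<close> species. The diffusivities enter only through continuity,
  nonnegativity and periodicity, so the structure of the nonlocal terms plays no role here.
\<close>

lemma implicit_step_exists:
  fixes m :: "nat \<Rightarrow> (nat \<Rightarrow> int \<Rightarrow> real) \<Rightarrow> int \<Rightarrow> real" and p :: "nat \<Rightarrow> int \<Rightarrow> real"
  assumes N: "N \<ge> 1" and n: "n \<ge> 1" and dt: "dt > 0"
    and p_per: "\<And>s. s < n \<Longrightarrow> grid_periodic N (p s)" and p_nn: "\<And>s i. s < n \<Longrightarrow> 0 \<le> p s i"
    and m_cont: "\<And>s i. s < n \<Longrightarrow> continuous_on UNIV (\<lambda>u. m s u i)"
    and m_nn: "\<And>s u i. s < n \<Longrightarrow> (\<And>t i. 0 \<le> u t i) \<Longrightarrow> 0 \<le> m s u i"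
    and m_per: "\<And>s u. s < n \<Longrightarrow> (\<And>t. grid_periodic N (u t)) \<Longrightarrow> grid_periodic N (m s u)"
  shows "\<exists>u. (\<forall>s. grid_periodic N (u s)) \<and> (\<forall>s i. 0 \<le> u s i) \<and>
           (\<forall>s<n. scheme_eq N dt (m s u) (p s) (u s))"
proof -
  define S where "S = {x :: nat \<Rightarrow> real. \<forall>i. 0 \<le> x i \<and> x i \<le> 1}"
  define I where "I = {0..<int N}"
  define B where "B = 1 + (\<Sum>s<n. \<Sum>i\<in>I. p s i)"
  have pB: "(\<Sum>i\<in>I. p s i) \<le> B" if "s < n" for s
    using member_le_sum[of s "{..<n}" "\<lambda>s. \<Sum>i\<in>I. p s i"] that p_nn
    by (simp add: B_def sum_nonneg)
  have B: "B > 0"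
    unfolding B_def using p_nn by (intro add_pos_nonneg sum_nonneg) auto
  \<comment> \<open>Cell \<open>c\<close> of species \<open>s < n\<close> sits at the coordinate \<open>n * c + s\<close>, scaled from \<open>[0, 1]\<close> to \<open>[0, B]\<close>.\<close>
  define w :: "(nat \<Rightarrow> real) \<Rightarrow> nat \<Rightarrow> int \<Rightarrow> real"
    where "w x s i = B * x (n * nat (i mod int N) + s)" for x s i
  have w_per: "grid_periodic N (w x s)" for x s
    by (simp add: grid_periodic_def w_def)
  have w_nn: "0 \<le> w x s i" if "x \<in> S" for x s i
    using that B by (simp add: S_def w_def)
  have w_cont: "continuous_on UNIV w"
    by (intro continuous_on_coordinatewise_then_product) (auto simp: w_def intro!: continuous_intros)
  have w_cont': "continuous_on UNIV (\<lambda>x. w x s i)" for s i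
    unfolding w_def by (auto intro!: continuous_intros)
  have mw_cont: "continuous_on UNIV (\<lambda>x. m s (w x) i)" if "s < n" for s i
    by (rule continuous_on_compose2[OF m_cont[OF that] w_cont]) auto
  have "\<exists>C. \<forall>x\<in>S. m s (w x) i \<le> C" if "s < n" for s i
  proof -
    have "compact ((\<lambda>x. m s (w x) i) ` S)"
      unfolding S_def
      by (intro compact_continuous_image compact_hilbert_cube continuous_on_subset[OF mw_cont[OF that]]) auto
    then have "bdd_above ((\<lambda>x. m s (w x) i) ` S)"
      by (intro bounded_imp_bdd_above compact_imp_bounded)
    then show ?thesis
      unfolding bdd_above_def by auto
  qed
  then obtain c where c: "\<And>s i x. s < n \<Longrightarrow> x \<in> S \<Longrightarrow> m s (w x) i \<le> c s i"
    by metis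
  define C where "C = (\<Sum>s<n. \<Sum>i\<in>I. \<bar>c s i\<bar>)"
  have C0: "C \<ge> 0" unfolding C_def by (intro sum_nonneg) auto
  have mC: "m s (w x) i \<le> C" if "s < n" "x \<in> S" for s x i
  proof -
    have iI: "i mod int N \<in> I" using N by (simp add: I_def)
    have "m s (w x) i = m s (w x) (i mod int N)"
      using grid_periodic_mod[OF m_per[OF \<open>s < n\<close>, of "w x"]] w_per by simp
    also have "\<dots> \<le> \<bar>c s (i mod int N)\<bar>"
      using c[OF that, of "i mod int N"] by linarith
    also have "\<dots> \<le> (\<Sum>i\<in>I. \<bar>c s i\<bar>)"
      using iI by (intro member_le_sum) (auto simp: I_def)
    also have "\<dots> \<le> C"
      unfolding C_def using \<open>s < n\<close>
      by (intro member_le_sum[of s "{..<n}" "\<lambda>s. \<Sum>i\<in>I. \<bar>c s i\<bar>"]) (auto intro: sum_nonneg)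
    finally show ?thesis .
  qed
  define lam where "lam = dt / (dx N)\<^sup>2"
  have lam: "lam \<ge> 0" using dt by (simp add: lam_def)
  \<comment> \<open>This \<open>tau\<close> makes the coefficient \<open>1 - tau * (1 + 2 * lam * m)\<close> of \<open>w x s i\<close> in one relaxed step nonnegative.\<close>
  obtain tau where tau: "tau > 0" "tau * (1 + 2 * lam * C) = 1"
  proof
    have *: "1 + 2 * lam * C > 0"
      using C0 lam by (intro add_pos_nonneg) auto
    show "inverse (1 + 2 * lam * C) > 0"
      by (rule positive_imp_inverse_positive[OF *])
    show "inverse (1 + 2 * lam * C) * (1 + 2 * lam * C) = 1"
      by (rule left_inverse) (use * in linarith)
  qed
  define M where "M x s i = m s (w x) i * w x s i" for x s i
  \<comment> \<open>The residual of the scheme; the species \<open>s < n\<close> solves it when \<open>F x s\<close> vanishes.\<close>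
  define F where "F x s i = p s i - w x s i + lam * (M x s (i + 1) - 2 * M x s i + M x s (i - 1))" for x s i
  have M_per: "grid_periodic N (M x s)" if "s < n" for x s
    using m_per[OF that, of "w x"] w_per by (simp add: M_def grid_periodic_def)
  have F_per: "grid_periodic N (F x s)" if "s < n" for x s
  proof -
    have "M x s (i + int N + 1) = M x s (i + 1)" "M x s (i + int N - 1) = M x s (i - 1)" for i
      using grid_periodic_add[OF M_per[OF that], of x "i + 1"]
        grid_periodic_add[OF M_per[OF that], of x "i - 1"] by (simp_all add: algebra_simps)
    then show ?thesis
      using p_per[OF that] w_per[of x s] M_per[OF that, of x] by (simp add: grid_periodic_def F_def)
  qed
  \<comment> \<open>The relaxed step, cut off at \<open>B\<close> and scaled back to the cube.\<close>
  define G where "G x k = min B (w x (k mod n) (int (k div n)) + tau * F x (k mod n) (int (k div n))) / B" for x k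
  have G_cont: "continuous_on UNIV G"
  proof (rule continuous_on_coordinatewise_then_product)
    fix k
    have "k mod n < n" using n by simp
    then show "continuous_on UNIV (\<lambda>x. G x k)"
      unfolding G_def F_def M_def
      using mw_cont w_cont' B by (intro continuous_intros) auto
  qed
  have G_nn: "0 \<le> w x s i + tau * F x s i" if "s < n" "x \<in> S" for x s i
  proof -
    have "tau * (1 + 2 * lam * m s (w x) i) \<le> 1"
      using mC[OF that, of i] tau lam
      by (metis add_left_mono less_imp_le mult_left_mono mult_nonneg_nonneg zero_le_numeral)
    then have "tau * (1 + 2 * lam * m s (w x) i) * w x s i \<le> 1 * w x s i"
      using w_nn[OF that(2)] by (intro mult_right_mono) auto
    moreover have "0 \<le> M x s j" for j
      unfolding M_def using m_nn[OF that(1)] w_nn[OF that(2)] by simp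
    then have "0 \<le> tau * (p s i + lam * (M x s (i + 1) + M x s (i - 1)))"
      using tau lam p_nn[OF that(1)] by (intro mult_nonneg_nonneg add_nonneg_nonneg) auto
    ultimately show ?thesis
      unfolding F_def M_def by (simp add: algebra_simps)
  qed
  have "G ` S \<subseteq> S"
  proof
    fix y assume "y \<in> G ` S"
    then obtain x where x: "x \<in> S" "y = G x" by blast
    have "0 \<le> G x k \<and> G x k \<le> 1" for k
      using G_nn[of "k mod n" x "int (k div n)"] x n B by (simp add: G_def)
    then show "y \<in> S" using x by (simp add: S_def)
  qed
  then obtain x where x: "x \<in> S" "G x = x"
    using hilbert_cube_fixpoint[of G] continuous_on_subset[OF G_cont] unfolding S_def by blast
  have fixpt: "w x s i = min B (w x s i + tau * F x s i)" if "s < n" for s i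
  proof -
    define k where "k = n * nat (i mod int N) + s"
    have k: "k mod n = s" "int (k div n) = i mod int N"
      using that N by (simp_all add: k_def)
    have "w x s i = B * G x k"
      by (simp add: w_def k_def x)
    also have "\<dots> = min B (w x s (i mod int N) + tau * F x s (i mod int N))"
      using B by (simp add: G_def k)
    also have "\<dots> = min B (w x s i + tau * F x s i)"
      using grid_periodic_mod[OF w_per] grid_periodic_mod[OF F_per[OF that]] by simp
    finally show ?thesis .
  qed
  have F_nn: "0 \<le> F x s i" if "s < n" for s i
  proof -
    have "0 \<le> tau * F x s i" using fixpt[OF that, of i] by linarith
    then show ?thesis using tau by (simp add: zero_le_mult_iff)
  qed
  have F0: "F x s i = 0" if s: "s < n" and i: "i \<in> I" for s i
  proof (rule ccontr)
    assume "F x s i \<noteq> 0"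
    then have pos: "0 < F x s i" using F_nn[OF s, of i] by simp
    then have "0 < tau * F x s i" using tau by simp
    \<comment> \<open>A positive residual is possible only where the truncation is active.\<close>
    then have "w x s i = B" using fixpt[OF s, of i] by linarith
    then have "B \<le> (\<Sum>i\<in>I. w x s i)"
      using member_le_sum[OF i, of "w x s"] w_nn[OF x(1)] by (simp add: I_def)
    moreover have "(\<Sum>i\<in>I. F x s i) = (\<Sum>i\<in>I. p s i) - (\<Sum>i\<in>I. w x s i)"
      using sum_grid_laplacian[OF N M_per[OF s, of x]]
      unfolding F_def I_def by (simp add: sum.distrib sum_subtractf flip: sum_distrib_left)
    moreover have "F x s i \<le> (\<Sum>i\<in>I. F x s i)"
      using member_le_sum[OF i, of "F x s"] F_nn[OF s] by (simp add: I_def)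
    ultimately show False using pos pB[OF s] by linarith
  qed
  have "scheme_eq N dt (m s (w x)) (p s) (w x s)" if s: "s < n" for s
  proof -
    have "F x s i = 0" for i
      using F0[OF s, of "i mod int N"] grid_periodic_mod[OF F_per[OF s]] N by (simp add: I_def)
    then show ?thesis
      unfolding scheme_eq_iff[OF dt] F_def M_def lam_def by blast
  qed
  then show ?thesis
    using w_per w_nn[OF x(1)] by blast
qed

section \<open>Cell averages\<close>

lemma borel_measurable_lebesgue_AE_cong:
  fixes f g :: "real \<Rightarrow> real"
  assumes f: "f \<in> borel_measurable lebesgue" and ae: "AE x in lebesgue. f x = g x"
  shows "g \<in> borel_measurable lebesgue"
proof (rule measurableI)
  fix A :: "real set" assume "A \<in> sets borel"
  then have "f -` A \<inter> space lebesgue \<in> sets lebesgue"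
    by (rule measurable_sets[OF f])
  moreover have "AE x in lebesgue. x \<in> f -` A \<inter> space lebesgue \<longleftrightarrow> x \<in> g -` A \<inter> space lebesgue"
    using ae by eventually_elim simp
  ultimately show "g -` A \<inter> space lebesgue \<in> sets lebesgue"
    using completion.in_sets_AE by blast
qed simp

lemma cell_avg_cong_AE:
  assumes "f \<in> borel_measurable lebesgue" "AE x in lebesgue. f x = g x"
  shows "cell_avg N f = cell_avg N g"
proof
  fix i
  have "cell N i \<in> sets lebesgue" by (simp add: cell_def)
  then have "(LINT x:cell N i|lebesgue. f x) = (LINT x:cell N i|lebesgue. g x)"
    using assms borel_measurable_lebesgue_AE_cong[OF assms]
    unfolding set_lebesgue_integral_def
    by (intro integral_cong_AE) auto
  then show "cell_avg N f i = cell_avg N g i"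
    by (simp add: cell_avg_def)
qed

lemma cell_avg_nonneg:
  assumes "AE x in lebesgue. 0 \<le> f x"
  shows "0 \<le> cell_avg N f i"
proof -
  have "AE x in lebesgue. 0 \<le> indicator (cell N i) x *\<^sub>R f x"
    using assms by eventually_elim (simp add: indicator_def)
  then show ?thesis
    unfolding cell_avg_def set_lebesgue_integral_def
    by (intro mult_nonneg_nonneg integral_nonneg_AE) (auto simp: dx_def)
qed

lemma set_integral_lebesgue_shift:
  fixes f :: "real \<Rightarrow> real"
  shows "(LINT x:S|lebesgue. f x) = (LINT x:{x. t + x \<in> S}|lebesgue. f (t + x))"
  using lebesgue_integral_real_affine[of 1 "\<lambda>x. indicator S x *\<^sub>R f x" t]
  by (simp add: set_lebesgue_integral_def indicator_def)

lemma torus_measurable_add_1: "torus_measurable f \<Longrightarrow> f (1 + x) = f x"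
  unfolding torus_measurable_def by (metis add.commute)

lemma cell_avg_periodic:
  assumes N: "N \<ge> 1" and f: "torus_measurable f"
  shows "grid_periodic N (cell_avg N f)"
proof -
  have "(LINT x:cell N (i + int N)|lebesgue. f x) = (LINT x:cell N i|lebesgue. f x)" for i
  proof -
    have "1 + x \<in> cell N (i + int N) \<longleftrightarrow> x \<in> cell N i" for x
      using N by (simp add: cell_def dx_def field_simps)
    moreover have "f (1 + x) = f x" for x
      using f by (rule torus_measurable_add_1)
    ultimately show ?thesis
      by (subst set_integral_lebesgue_shift[of _ _ 1]) simp
  qed
  then show ?thesis
    by (simp add: grid_periodic_def cell_avg_def)
qed

lemma cell_avg_reflect: "cell_avg N f (- i) = cell_avg N (\<lambda>x. f (- x)) i"
proof -
  have "- x \<in> cell N (- i) \<longleftrightarrow> x \<in> cell N i" for x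
    by (auto simp: cell_def field_simps)
  then have "(LINT x:cell N (- i)|lebesgue. f x) = (LINT x:cell N i|lebesgue. f (- x))"
    using lebesgue_integral_real_affine[of "-1" "\<lambda>x. indicator (cell N (- i)) x *\<^sub>R f x" 0]
    by (simp add: set_lebesgue_integral_def indicator_def)
  then show ?thesis
    by (simp add: cell_avg_def)
qed

lemma torus_measurable_borel: "torus_measurable f \<Longrightarrow> f \<in> borel_measurable lebesgue"
  by (simp add: torus_measurable_def)

lemma torus_measurable_reflect_borel:
  "torus_measurable f \<Longrightarrow> (\<lambda>x. f (- x)) \<in> borel_measurable lebesgue"
  using borel_measurable_affine[of f "-1" 0] by (simp add: torus_measurable_def)

lemma AE_lebesgue_not_eq: "AE x in lebesgue. x \<noteq> (a :: real)"
  by (rule AE_completion[OF AE_lborel_singleton])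

text \<open>
  The cells cover, up to null sets, the interval from \<open>- dx / 2\<close> to \<open>1 - dx / 2\<close>, so the part left of
  the origin has to be moved by one period.
\<close>

lemma sum_cell_avg:
  assumes N: "N \<ge> 1" and f: "L1_torus f"
  shows "(\<Sum>i\<in>{0..<int N}. dx N * cell_avg N f i) = torus_integral f"
proof -
  define m where "m = dx N / 2"
  \<comment> \<open>Half-open versions of the cells, which partition the interval exactly.\<close>
  define K where "K i = {(of_int i - 1/2) * dx N ..< (of_int i + 1/2) * dx N}" for i :: int
  have dx: "dx N > 0" "real N * dx N = 1" using N by (simp_all add: dx_def)
  have m: "0 < m" "m < 1" using N by (simp_all add: m_def dx_def)
  have f1: "f (1 + x) = f x" for x
    using f by (intro torus_measurable_add_1) (simp add: L1_torus_def)
  have fm: "f \<in> borel_measurable lebesgue"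
    using f by (simp add: L1_torus_def torus_measurable_def)
  have int01: "set_integrable lebesgue {0..<1} f"
    using f by (simp add: L1_torus_def)
  have int_neg: "set_integrable lebesgue {-m..<0} f"
  proof -
    have "set_integrable lebesgue {1 - m..<1} f"
      by (rule set_integrable_subset[OF int01]) (use m in auto)
    then have "integrable lebesgue (\<lambda>x. indicator {1 - m..<1} (1 + 1 * x) *\<^sub>R f (1 + 1 * x))"
      unfolding set_integrable_def by (rule lebesgue_integrable_real_affine) simp
    moreover have "indicator {1 - m..<1} (1 + 1 * x) *\<^sub>R f (1 + 1 * x) = indicator {-m..<0} x *\<^sub>R f x" for x
      by (simp add: f1 indicator_def)
    ultimately show ?thesis
      by (simp add: set_integrable_def)
  qed
  have int_l: "set_integrable lebesgue {0..<1 - m} f" and int_r: "set_integrable lebesgue {1 - m..<1} f"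
    by (rule set_integrable_subset[OF int01], use m in auto)+
  have un: "{-m..<0} \<union> {0..<1 - m} = {-m..<1 - m}" "{0..<1 - m} \<union> {1 - m..<1} = {0..<1}"
    using m by auto
  have K_sub: "K i \<subseteq> {-m..<1 - m}" if i: "i \<in> {0..<int N}" for i
  proof
    fix x assume "x \<in> K i"
    then have "of_int i * dx N - m \<le> x" "x < of_int i * dx N + m"
      by (simp_all add: K_def m_def algebra_simps)
    moreover have "of_int i * dx N + 2 * m \<le> 1"
    proof -
      have "real_of_int i + 1 \<le> real N" using i by simp
      then have "(of_int i + 1) * dx N \<le> real N * dx N"
        using dx(1) by (intro mult_right_mono) auto
      then show ?thesis
        unfolding dx(2) by (simp add: m_def distrib_right)
    qed
    moreover have "0 \<le> of_int i * dx N" using i dx(1) by simp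
    ultimately show "x \<in> {-m..<1 - m}"
      unfolding atLeastLessThan_iff by linarith
  qed
  have int_K: "set_integrable lebesgue (K i) f" if "i \<in> {0..<int N}" for i
  proof (rule set_integrable_subset)
    show "set_integrable lebesgue {-m..<1 - m} f"
      unfolding un(1)[symmetric] by (rule set_integrable_Un[OF int_neg int_l]) auto
    show "K i \<subseteq> {-m..<1 - m}" by (rule K_sub[OF that])
  qed (simp add: K_def)
  have UK: "(\<Union>i\<in>{0..<int N}. K i) = {-m..<1 - m}"
  proof (intro set_eqI iffI)
    fix x assume "x \<in> (\<Union>i\<in>{0..<int N}. K i)"
    then show "x \<in> {-m..<1 - m}" using K_sub by blast
  next
    fix x assume x: "x \<in> {-m..<1 - m}"
    define i where "i = \<lfloor>x / dx N + 1/2\<rfloor>"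
    have i: "of_int i \<le> x / dx N + 1/2" "x / dx N + 1/2 < of_int i + 1"
      unfolding i_def by linarith+
    then have "x \<in> K i"
      using dx(1) by (simp add: K_def field_simps)
    moreover have "0 \<le> x / dx N + 1/2" "x / dx N + 1/2 < real N"
      using x dx by (simp_all add: m_def field_simps)
    then have "0 \<le> i" "i < int N"
      using i by (simp_all add: i_def floor_less_iff)
    ultimately show "x \<in> (\<Union>i\<in>{0..<int N}. K i)" by auto
  qed
  have disj: "disjoint_family_on K {0..<int N}"
  proof (unfold disjoint_family_on_def, intro ballI impI)
    fix i j :: int assume "i \<noteq> j"
    then consider "i + 1 \<le> j" | "j + 1 \<le> i" by linarith
    then have "(of_int i + 1) * dx N \<le> of_int j * dx N \<or> (of_int j + 1) * dx N \<le> of_int i * dx N"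
      using dx(1) by cases (auto intro!: mult_right_mono)
    then show "K i \<inter> K j = {}"
      by (auto simp: K_def algebra_simps)
  qed
  have cellK: "(LINT x:cell N i|lebesgue. f x) = (LINT x:K i|lebesgue. f x)" for i
    unfolding set_lebesgue_integral_def
  proof (rule integral_cong_AE)
    have "cell N i \<in> sets lebesgue" "K i \<in> sets lebesgue"
      by (simp_all add: cell_def K_def)
    then show "(\<lambda>x. indicator (cell N i) x *\<^sub>R f x) \<in> borel_measurable lebesgue"
      "(\<lambda>x. indicator (K i) x *\<^sub>R f x) \<in> borel_measurable lebesgue"
      using fm by auto
    show "AE x in lebesgue. indicator (cell N i) x *\<^sub>R f x = indicator (K i) x *\<^sub>R f x"
      using AE_lebesgue_not_eq[of "(of_int i - 1/2) * dx N"]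
      by eventually_elim (auto simp: indicator_def cell_def K_def)
  qed
  have "(\<Sum>i\<in>{0..<int N}. dx N * cell_avg N f i) = (\<Sum>i\<in>{0..<int N}. LINT x:K i|lebesgue. f x)"
    using dx(1) by (simp add: cell_avg_def cellK)
  also have "\<dots> = (LINT x:{-m..<1 - m}|lebesgue. f x)"
    unfolding UK[symmetric]
    by (rule set_integral_finite_Union[symmetric, OF _ disj int_K]) (simp_all add: K_def)
  also have "\<dots> = (LINT x:{-m..<0}|lebesgue. f x) + (LINT x:{0..<1 - m}|lebesgue. f x)"
    unfolding un(1)[symmetric] by (rule set_integral_Un) (use int_neg int_l in auto)
  also have "(LINT x:{-m..<0}|lebesgue. f x) = (LINT x:{1 - m..<1}|lebesgue. f x)"
  proof -
    have "{x. 1 + x \<in> {1 - m..<1}} = {-m..<0}" by auto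
    then show ?thesis
      by (subst set_integral_lebesgue_shift[of "{1 - m..<1}" _ 1]) (simp add: f1)
  qed
  also have "\<dots> + (LINT x:{0..<1 - m}|lebesgue. f x) = torus_integral f"
    unfolding torus_integral_def un(2)[symmetric]
    by (subst set_integral_Un) (use int_l int_r in auto)
  finally show ?thesis .
qed

section \<open>Logarithmic inequalities\<close>

lemma two_diff_le_ln:
  assumes "x \<ge> (1::real)"
  shows "2 * (x - 1) \<le> (x + 1) * ln x"
proof -
  have "(\<lambda>x. (x + 1) * ln x - 2 * (x - 1)) 1 \<le> (\<lambda>x. (x + 1) * ln x - 2 * (x - 1)) x"
  proof (rule DERIV_nonneg_imp_nondecreasing[OF assms])
    fix t :: real assume t: "1 \<le> t" "t \<le> x"
    have "((\<lambda>x. (x + 1) * ln x - 2 * (x - 1)) has_real_derivative (ln t + (t + 1) / t - 2)) (at t)"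
      using t by (auto intro!: derivative_eq_intros)
    moreover have "0 \<le> ln t + (t + 1) / t - 2"
      using t ln_le_minus_one[of "1 / t"] by (simp add: ln_div field_simps)
    ultimately show "\<exists>y. ((\<lambda>x. (x + 1) * ln x - 2 * (x - 1)) has_real_derivative y) (at t) \<and> 0 \<le> y"
      by blast
  qed
  then show ?thesis by simp
qed

lemma sqrt_diff_sq_le_ln_diff:
  assumes a: "a > 0" and b: "b > 0"
  shows "4 * (sqrt a - sqrt b)\<^sup>2 \<le> (a - b) * (ln a - ln b)"
  using a b
proof (induction a b rule: linorder_wlog)
  case (le b a)
  define s t where "s = sqrt a" and "t = sqrt b"
  have st: "0 < t" "t \<le> s" "a = s\<^sup>2" "b = t\<^sup>2"
    using le by (auto simp: s_def t_def)
  have "2 * (s / t - 1) \<le> (s / t + 1) * ln (s / t)"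
    by (rule two_diff_le_ln) (use st in simp)
  then have "t * (2 * (s / t - 1)) \<le> t * ((s / t + 1) * ln (s / t))"
    using st by (intro mult_left_mono) auto
  then have "2 * (s - t) \<le> (s + t) * (ln s - ln t)"
    using st by (simp add: ln_div algebra_simps)
  then have "2 * (s - t) * (2 * (s - t)) \<le> 2 * (s - t) * ((s + t) * (ln s - ln t))"
    using st by (intro mult_left_mono) auto
  moreover have "ln a = 2 * ln s" "ln b = 2 * ln t"
    using st by (simp_all add: ln_realpow)
  ultimately have "4 * (s - t)\<^sup>2 \<le> (a - b) * (ln a - ln b)"
    using st(3,4) by (simp add: algebra_simps power2_eq_square)
  then show ?case
    by (simp add: s_def t_def power2_commute algebra_simps)
next
  case (sym a b)
  then show ?case by (simp add: power2_commute algebra_simps)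
qed

text \<open>
  The tangent inequality for the convex entropy density. At \<open>u = 0\<close> the tangent is vertical, and the
  inequality survives, with \<open>ln 0 = 0\<close>, because then \<open>p\<close> vanishes too.
\<close>

lemma entropy_density_diff_le:
  assumes d: "d > 0" and u: "0 \<le> u" and p: "0 \<le> p" and z: "u = 0 \<Longrightarrow> p = 0"
  shows "entropy_density d u - entropy_density d p \<le> 1 / d * ((u - p) * ln u)"
proof -
  have "(u * (ln u - 1) + 1) - (p * (ln p - 1) + 1) \<le> (u - p) * ln u"
  proof (cases "p = 0 \<or> u = 0")
    case True
    then show ?thesis using u z by (auto simp: algebra_simps)
  next
    case False
    then have pos: "0 < u" "0 < p" using u p by auto
    then have "p * ln (u / p) \<le> p * (u / p - 1)"
      by (intro mult_left_mono ln_le_minus_one) auto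
    then show ?thesis
      using pos by (simp add: ln_div algebra_simps)
  qed
  then have "1 / d * ((u * (ln u - 1) + 1) - (p * (ln p - 1) + 1)) \<le> 1 / d * ((u - p) * ln u)"
    using d by (intro mult_left_mono) auto
  then show ?thesis
    by (simp only: entropy_density_def right_diff_distrib[of "1 / d"])
qed

section \<open>Consequences of the scheme for one species\<close>

text \<open>
  Where the solution vanishes, the scheme equates a sum of nonnegative terms to zero.
\<close>

lemma scheme_eq_zero:
  assumes N: "N \<ge> 1" and dt: "dt > 0" and eq: "scheme_eq N dt \<mu> p u"
    and nn: "\<And>i. 0 \<le> u i" "\<And>i. 0 \<le> p i" "\<And>i. 0 \<le> \<mu> i" and z: "u i = 0"
  shows "p i = 0" "\<mu> (i + 1) * u (i + 1) = 0" "\<mu> (i - 1) * u (i - 1) = 0"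
proof -
  define lam where "lam = dt / (dx N)\<^sup>2"
  have lam: "lam > 0" using N dt by (simp add: lam_def dx_def)
  have "p i + (lam * (\<mu> (i + 1) * u (i + 1)) + lam * (\<mu> (i - 1) * u (i - 1))) = 0"
    using eq[unfolded scheme_eq_iff[OF dt], rule_format, of i] z
    by (simp add: lam_def algebra_simps)
  moreover have "0 \<le> p i" "0 \<le> lam * (\<mu> (i + 1) * u (i + 1))" "0 \<le> lam * (\<mu> (i - 1) * u (i - 1))"
    using nn lam by auto
  ultimately have "p i = 0" "lam * (\<mu> (i + 1) * u (i + 1)) = 0" "lam * (\<mu> (i - 1) * u (i - 1)) = 0"
    by linarith+
  then show "p i = 0" "\<mu> (i + 1) * u (i + 1) = 0" "\<mu> (i - 1) * u (i - 1) = 0"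
    using lam by auto
qed

lemma scheme_eq_mass:
  assumes N: "N \<ge> 1" and dt: "dt > 0" and eq: "scheme_eq N dt \<mu> p u"
    and per: "grid_periodic N u" "grid_periodic N \<mu>"
  shows "(\<Sum>i\<in>{0..<int N}. u i) = (\<Sum>i\<in>{0..<int N}. p i)"
proof -
  define f where "f i = \<mu> i * u i" for i
  define lam where "lam = dt / (dx N)\<^sup>2"
  have f: "grid_periodic N f"
    using per by (simp add: f_def grid_periodic_def)
  have "p i - u i + lam * (f (i+1) - 2 * f i + f (i-1)) = 0" for i
    using eq unfolding scheme_eq_iff[OF dt] f_def lam_def by blast
  then have "(\<Sum>i\<in>{0..<int N}. p i - u i + lam * (f (i+1) - 2 * f i + f (i-1))) = 0"
    by simp
  then show ?thesis
    using sum_grid_laplacian[OF N f] by (simp add: sum.distrib sum_subtractf flip: sum_distrib_left)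
qed

lemma scheme_eq_pos:
  assumes N: "N \<ge> 1" and dt: "dt > 0" and eq: "scheme_eq N dt \<mu> p u"
    and nn: "\<And>i. 0 \<le> u i" "\<And>i. 0 \<le> p i" and \<mu>: "\<And>i. 0 < \<mu> i"
    and mass: "0 < (\<Sum>i\<in>{0..<int N}. u i)"
  shows "0 < u i"
proof (rule ccontr)
  assume "\<not> 0 < u i"
  then have i: "u i = 0" using nn(1)[of i] by linarith
  have step: "u (k + 1) = 0" "u (k - 1) = 0" if "u k = 0" for k
    using scheme_eq_zero(2,3)[OF N dt eq nn less_imp_le[OF \<mu>] that] \<mu> by (auto simp: less_imp_neq[symmetric])
  have "u k = 0" for k
    by (induction k rule: int_induct[of _ i]) (use i step in auto)
  then show False using mass by simp
qed

lemma sum_grid_by_parts: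
  fixes f g :: "int \<Rightarrow> real"
  assumes N: "N \<ge> 1" and f: "grid_periodic N f" and g: "grid_periodic N g"
  shows "(\<Sum>i\<in>{0..<int N}. (f (i + 1) - 2 * f i + f (i - 1)) * g i) =
         - (\<Sum>i\<in>{0..<int N}. (f (i + 1) - f i) * (g (i + 1) - g i))"
proof -
  have per: "grid_periodic N (\<lambda>i. (f i - f (i - 1)) * g i)"
    using f g grid_periodic_add[OF f, of "_ - 1"] by (simp add: grid_periodic_def algebra_simps)
  have "(\<Sum>i\<in>{0..<int N}. (f (i + 1) - f i) * g (i + 1)) = (\<Sum>i\<in>{0..<int N}. (f i - f (i - 1)) * g i)"
    using sum_grid_shift[OF N per, of 1] by simp
  then show ?thesis
    by (simp add: algebra_simps sum.distrib sum_subtractf sum_distrib_left)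
qed

lemma scheme_eq_entropy:
  assumes N: "N \<ge> 1" and dt: "dt > 0" and d: "d > 0" and eq: "scheme_eq N dt \<mu> p u"
    and nn: "\<And>i. 0 \<le> u i" "\<And>i. 0 \<le> p i" "\<And>i. 0 \<le> \<mu> i"
    and per: "grid_periodic N u" "grid_periodic N \<mu>"
  shows "(\<Sum>i\<in>{0..<int N}. dx N * entropy_density d (u i)) +
      dt / dx N * (1 / d) *
        (\<Sum>i\<in>{0..<int N}. (\<mu> (i + 1) * u (i + 1) - \<mu> i * u i) * (ln (u (i + 1)) - ln (u i)))
    \<le> (\<Sum>i\<in>{0..<int N}. dx N * entropy_density d (p i))"
proof -
  define f where "f i = \<mu> i * u i" for i
  have dx: "dx N > 0" using N by (simp add: dx_def)
  have f: "grid_periodic N f" and l: "grid_periodic N (\<lambda>i. ln (u i))"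
    using per by (simp_all add: f_def grid_periodic_def)
  have diff: "u i - p i = dt / (dx N)\<^sup>2 * (f (i + 1) - 2 * f i + f (i - 1))" for i
    using eq[unfolded scheme_eq_iff[OF dt], rule_format, of i] by (simp add: f_def)
  have "(\<Sum>i\<in>{0..<int N}. dx N * entropy_density d (u i)) - (\<Sum>i\<in>{0..<int N}. dx N * entropy_density d (p i))
      = (\<Sum>i\<in>{0..<int N}. dx N * (entropy_density d (u i) - entropy_density d (p i)))"
    by (simp add: right_diff_distrib sum_subtractf)
  also have "\<dots> \<le> (\<Sum>i\<in>{0..<int N}. dx N * (1 / d * ((u i - p i) * ln (u i))))"
    using dx d nn scheme_eq_zero(1)[OF N dt eq nn]
    by (intro sum_mono mult_left_mono entropy_density_diff_le) auto
  also have "\<dots> = (\<Sum>i\<in>{0..<int N}. dt / dx N * (1 / d) * ((f (i + 1) - 2 * f i + f (i - 1)) * ln (u i)))"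
    unfolding diff using dx by (intro sum.cong refl) (simp add: power2_eq_square)
  also have "\<dots> = - (dt / dx N * (1 / d) * (\<Sum>i\<in>{0..<int N}. (f (i + 1) - f i) * (ln (u (i + 1)) - ln (u i))))"
    by (simp only: sum_distrib_left[symmetric] sum_grid_by_parts[OF N f l] mult_minus_right)
  finally show ?thesis
    by (simp add: f_def)
qed

section \<open>Dissipation of the nonlocal terms\<close>

text \<open>
  The contribution of a nonlocal term with kernel \<open>w\<close> to the entropy production of the species \<open>u\<close>:
  the discrete gradient of \<open>u (w * v)\<close> paired with the discrete gradient of \<open>ln u\<close>. The convolution
  is expanded in the lag \<open>j\<close> and the mesh size is dropped.
\<close>

definition log_pairing ::
  "nat \<Rightarrow> (int \<Rightarrow> real) \<Rightarrow> (int \<Rightarrow> real) \<Rightarrow> (int \<Rightarrow> real) \<Rightarrow> real" where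
  "log_pairing N w u v =
     (\<Sum>j\<in>{0..<int N}. w j * (\<Sum>i\<in>{0..<int N}.
        (u (i + 1) * v (i + 1 - j) - u i * v (i - j)) * (ln (u (i + 1)) - ln (u i))))"

text \<open>
  Reflecting the kernel and exchanging the species keeps the products \<open>u i * v (i - j)\<close> and moves the
  logarithm to the other factor.
\<close>

lemma log_pairing_transpose:
  assumes N: "N \<ge> 1" and u: "grid_periodic N u" and v: "grid_periodic N v" and w: "grid_periodic N w"
  shows "log_pairing N (\<lambda>j. w (- j)) v u =
     (\<Sum>j\<in>{0..<int N}. w j * (\<Sum>i\<in>{0..<int N}.
        (u (i + 1) * v (i + 1 - j) - u i * v (i - j)) * (ln (v (i + 1 - j)) - ln (v (i - j)))))"
proof -
  define g where "g j = w j * (\<Sum>i\<in>{0..<int N}.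
     (v (i + 1) * u (i + 1 + j) - v i * u (i + j)) * (ln (v (i + 1)) - ln (v i)))" for j
  have g: "grid_periodic N g"
  proof -
    have "u (i + (j + int N)) = u (i + j)" for i j
      using grid_periodic_add[OF u, of "i + j"] by (simp add: add.assoc)
    then show ?thesis
      using grid_periodic_add[OF w] by (simp add: grid_periodic_def g_def)
  qed
  have "log_pairing N (\<lambda>j. w (- j)) v u = (\<Sum>j\<in>{0..<int N}. g (0 - j))"
    by (simp add: log_pairing_def g_def)
  also have "\<dots> = (\<Sum>j\<in>{0..<int N}. g j)"
    by (rule sum_grid_reflect[OF N g])
  also have "\<dots> = (\<Sum>j\<in>{0..<int N}. w j * (\<Sum>i\<in>{0..<int N}.
        (u (i + 1) * v (i + 1 - j) - u i * v (i - j)) * (ln (v (i + 1 - j)) - ln (v (i - j)))))"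
  proof (intro sum.cong refl)
    fix j
    define h where "h i = (v (i + 1) * u (i + 1 + j) - v i * u (i + j)) * (ln (v (i + 1)) - ln (v i))" for i
    have h: "grid_periodic N h"
    proof -
      have "u (i + int N + j) = u (i + j)" "u (i + int N + 1 + j) = u (i + 1 + j)"
        "v (i + int N + 1) = v (i + 1)" for i
        using grid_periodic_add[OF u, of "i + j"] grid_periodic_add[OF u, of "i + 1 + j"]
          grid_periodic_add[OF v, of "i + 1"] by (simp_all add: ac_simps)
      then show ?thesis
        using grid_periodic_add[OF v] by (simp add: grid_periodic_def h_def)
    qed
    have "(\<Sum>i\<in>{0..<int N}. h i) = (\<Sum>i\<in>{0..<int N}. h (i + (- j)))"
      by (rule sum_grid_shift[OF N h, symmetric])
    also have "\<dots> = (\<Sum>i\<in>{0..<int N}.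
        (u (i + 1) * v (i + 1 - j) - u i * v (i - j)) * (ln (v (i + 1 - j)) - ln (v (i - j))))"
      unfolding h_def by (intro sum.cong refl) (simp add: algebra_simps)
    finally show "g j = w j * (\<Sum>i\<in>{0..<int N}.
        (u (i + 1) * v (i + 1 - j) - u i * v (i - j)) * (ln (v (i + 1 - j)) - ln (v (i - j))))"
      by (simp add: g_def h_def)
  qed
  finally show ?thesis .
qed

text \<open>
  The two logarithmic differences add up to that of the products \<open>u i * v (i - j)\<close>, provided that
  all factors are positive. The assumptions \<open>zu\<close> and \<open>zv\<close> make the products vanish on both sides
  of a zero; they are what \<open>scheme_eq_zero\<close> gives for a solution.
\<close>

lemma pair_dissipation_le_log_pairing:
  assumes N: "N \<ge> 1" and per: "grid_periodic N u" "grid_periodic N v" "grid_periodic N w"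
    and nn: "\<And>i. 0 \<le> u i" "\<And>i. 0 \<le> v i" "\<And>i. 0 \<le> w i"
    and zu: "\<And>i j. u i = 0 \<Longrightarrow> w j * (u (i + 1) * v (i + 1 - j)) = 0 \<and> w j * (u (i - 1) * v (i - 1 - j)) = 0"
    and zv: "\<And>i j. v i = 0 \<Longrightarrow> w (- j) * (v (i + 1) * u (i + 1 - j)) = 0 \<and> w (- j) * (v (i - 1) * u (i - 1 - j)) = 0"
  shows "4 * pair_dissipation N w u v \<le> log_pairing N w u v + log_pairing N (\<lambda>j. w (- j)) v u"
proof -
  have term_le: "w j * (4 * (sqrt (u (i + 1) * v (i + 1 - j)) - sqrt (u i * v (i - j)))\<^sup>2)
    \<le> w j * ((u (i + 1) * v (i + 1 - j) - u i * v (i - j)) * (ln (u (i + 1)) - ln (u i))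
          + (u (i + 1) * v (i + 1 - j) - u i * v (i - j)) * (ln (v (i + 1 - j)) - ln (v (i - j))))"
    (is "w j * ?L \<le> w j * ?R") for i j
  proof (cases "w j = 0")
    case False
    have "?L \<le> ?R"
    proof (cases "u (i + 1) = 0 \<or> u i = 0 \<or> v (i + 1 - j) = 0 \<or> v (i - j) = 0")
      case True
      have "u (i + 1) * v (i + 1 - j) = 0 \<and> u i * v (i - j) = 0"
        using True False zu[of i j] zu[of "i + 1" j] zv[of "i - j" "- j"] zv[of "i + 1 - j" "- j"]
        by (auto simp: algebra_simps)
      then show ?thesis by (simp only:) simp
    next
      case False
      then have pos: "0 < u (i + 1)" "0 < u i" "0 < v (i + 1 - j)" "0 < v (i - j)"
        using nn(1)[of i] nn(1)[of "i + 1"] nn(2)[of "i - j"] nn(2)[of "i + 1 - j"] by linarith+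
      then have "ln (u (i + 1) * v (i + 1 - j)) = ln (u (i + 1)) + ln (v (i + 1 - j))"
        "ln (u i * v (i - j)) = ln (u i) + ln (v (i - j))"
        by (simp_all add: ln_mult)
      then show ?thesis
        using sqrt_diff_sq_le_ln_diff[of "u (i + 1) * v (i + 1 - j)" "u i * v (i - j)"] pos
        by (simp add: algebra_simps)
    qed
    then show ?thesis using nn(3) by (rule mult_left_mono)
  qed simp
  have "4 * pair_dissipation N w u v =
      (\<Sum>j\<in>{0..<int N}. \<Sum>i\<in>{0..<int N}. w j * (4 * (sqrt (u (i + 1) * v (i + 1 - j)) - sqrt (u i * v (i - j)))\<^sup>2))"
    by (simp add: pair_dissipation_def sum_distrib_left mult.left_commute)
  also have "\<dots> \<le> (\<Sum>j\<in>{0..<int N}. \<Sum>i\<in>{0..<int N}.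
        w j * ((u (i + 1) * v (i + 1 - j) - u i * v (i - j)) * (ln (u (i + 1)) - ln (u i))
          + (u (i + 1) * v (i + 1 - j) - u i * v (i - j)) * (ln (v (i + 1 - j)) - ln (v (i - j)))))"
    by (intro sum_mono term_le)
  also have "\<dots> = log_pairing N w u v + log_pairing N (\<lambda>j. w (- j)) v u"
    unfolding log_pairing_transpose[OF N per] unfolding log_pairing_def
    by (simp only: sum_distrib_left[symmetric] sum.distrib[symmetric] distrib_left[symmetric])
  finally show ?thesis .
qed

lemma grid_conv_periodic: "grid_periodic N w \<Longrightarrow> grid_periodic N (grid_conv N w u)"
  using grid_periodic_add[of N w "i - n" for i n]
  by (simp add: grid_conv_def grid_periodic_def algebra_simps)

lemma grid_conv_nonneg:
  "(\<And>i. 0 \<le> w i) \<Longrightarrow> (\<And>i. 0 \<le> u i) \<Longrightarrow> 0 \<le> grid_conv N w u i"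
  by (simp add: grid_conv_def dx_def sum_nonneg)

lemma grid_conv_commute:
  assumes N: "N \<ge> 1" and w: "grid_periodic N w" and u: "grid_periodic N u"
  shows "grid_conv N w u i = (\<Sum>j\<in>{0..<int N}. dx N * w j * u (i - j))"
proof -
  define f where "f n = dx N * w (i - n) * u n" for n
  have "w (i - (n + int N)) = w (i - n)" for n
    using grid_periodic_add[OF w, of "i - (n + int N)"] by simp
  then have "grid_periodic N f"
    using grid_periodic_add[OF u] by (simp add: grid_periodic_def f_def)
  from sum_grid_reflect[OF N this, of i] show ?thesis
    by (simp add: grid_conv_def f_def)
qed

text \<open>If a product with a convolution of nonnegative functions vanishes, so does each summand.\<close>

lemma grid_conv_mult_eq_0:
  assumes N: "N \<ge> 1" and w: "grid_periodic N w" and v: "grid_periodic N v"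
    and nn: "\<And>i. 0 \<le> w i" "\<And>i. 0 \<le> v i" and z: "grid_conv N w v k * y = 0"
  shows "w j * (y * v (k - j)) = 0"
proof (cases "y = 0")
  case False
  define j' where "j' = j mod int N"
  have j': "j' \<in> {0..<int N}" using N by (simp add: j'_def)
  have dx: "dx N > 0" using N by (simp add: dx_def)
  have "(\<Sum>j\<in>{0..<int N}. dx N * w j * v (k - j)) = 0"
    using z False by (simp add: grid_conv_commute[OF N w v])
  then have "dx N * w j' * v (k - j') = 0"
    using j' dx nn by (subst (asm) sum_nonneg_eq_0_iff) auto
  moreover have "w j' = w j" "v (k - j') = v (k - j)"
    by (auto intro!: grid_periodic_mod_eq[OF w] grid_periodic_mod_eq[OF v] simp: j'_def mod_diff_right_eq)
  ultimately show ?thesis using dx by auto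
qed simp

lemma grid_conv_flux:
  assumes N: "N \<ge> 1" and w: "grid_periodic N w" and v: "grid_periodic N v"
  shows "(\<Sum>i\<in>{0..<int N}. (grid_conv N w v (i + 1) * u (i + 1) - grid_conv N w v i * u i) * (ln (u (i + 1)) - ln (u i)))
    = dx N * log_pairing N w u v"
proof -
  have "(grid_conv N w v (i + 1) * u (i + 1) - grid_conv N w v i * u i) * (ln (u (i + 1)) - ln (u i))
    = (\<Sum>j\<in>{0..<int N}. dx N * (w j * ((u (i + 1) * v (i + 1 - j) - u i * v (i - j)) * (ln (u (i + 1)) - ln (u i)))))" for i
    unfolding grid_conv_commute[OF N w v] sum_distrib_right sum_subtractf[symmetric]
    by (intro sum.cong refl) (simp add: algebra_simps)
  then have "(\<Sum>i\<in>{0..<int N}. (grid_conv N w v (i + 1) * u (i + 1) - grid_conv N w v i * u i) * (ln (u (i + 1)) - ln (u i)))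
    = (\<Sum>i\<in>{0..<int N}. \<Sum>j\<in>{0..<int N}. dx N * (w j * ((u (i + 1) * v (i + 1 - j) - u i * v (i - j)) * (ln (u (i + 1)) - ln (u i)))))"
    by simp
  also have "\<dots> = dx N * log_pairing N w u v"
    unfolding log_pairing_def sum_distrib_left by (rule sum.swap)
  finally show ?thesis .
qed

lemma h1_seminorm_sq_eq:
  assumes "N \<ge> 1"
  shows "dx N * h1_seminorm_sq N f = (\<Sum>i\<in>{0..<int N}. (f (i + 1) - f i)\<^sup>2)"
  unfolding h1_seminorm_sq_def sum_distrib_left
  using assms by (intro sum.cong refl) (simp add: dx_def power2_eq_square)

text \<open>
  The entropy balance of a single species with all its local and self-interaction dissipation. The
  cross term stays a \<open>log_pairing\<close>, since only the sum over both species has a sign. The second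
  conclusion is the vanishing condition needed to estimate that sum.
\<close>

lemma one_species_entropy:
  fixes d ds dc :: real and N :: nat and u v s r :: "int \<Rightarrow> real"
  defines "\<mu> \<equiv> \<lambda>i. d + ds * grid_conv N s u i + dc * grid_conv N r v i"
  assumes N: "N \<ge> 1" and dt: "dt > 0" and d: "d \<ge> 0" "ds \<ge> 0" "dc > 0"
    and eq: "scheme_eq N dt \<mu> p u"
    and per: "grid_periodic N u" "grid_periodic N v" "grid_periodic N s" "grid_periodic N r"
    and nn: "\<And>i. 0 \<le> u i" "\<And>i. 0 \<le> v i" "\<And>i. 0 \<le> p i" "\<And>i. 0 \<le> s i" "\<And>i. 0 \<le> r i"
    and s_sym: "\<And>j. s (- j) = s j"
  shows "(\<Sum>i\<in>{0..<int N}. dx N * entropy_density dc (u i)) +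
      dt * (4 * (d / dc) * h1_seminorm_sq N (\<lambda>i. sqrt (u i)) + 2 * (ds / dc) * pair_dissipation N s u u
            + log_pairing N r u v)
    \<le> (\<Sum>i\<in>{0..<int N}. dx N * entropy_density dc (p i))" (is ?entropy)
    and "\<And>i j. u i = 0 \<Longrightarrow> r j * (u (i + 1) * v (i + 1 - j)) = 0 \<and> r j * (u (i - 1) * v (i - 1 - j)) = 0"
proof -
  have dx: "dx N > 0" using N by (simp add: dx_def)
  have parts_nn: "0 \<le> grid_conv N s u i" "0 \<le> grid_conv N r v i" for i
    using nn by (auto intro!: grid_conv_nonneg)
  have \<mu>_nn: "0 \<le> \<mu> i" for i
    using parts_nn d by (simp add: \<mu>_def)
  have \<mu>_per: "grid_periodic N \<mu>"
    using grid_conv_periodic[OF per(3), of u] grid_conv_periodic[OF per(4), of v]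
    by (simp add: \<mu>_def grid_periodic_def)
  have split: "d * u k = 0 \<and> (ds = 0 \<or> s j * (u k * u (k - j)) = 0) \<and> r j * (u k * v (k - j)) = 0"
    if "\<mu> k * u k = 0" for k j
  proof -
    have "d * u k + ds * (grid_conv N s u k * u k) + dc * (grid_conv N r v k * u k) = 0"
      using that by (simp add: \<mu>_def algebra_simps)
    moreover have "0 \<le> d * u k" "0 \<le> ds * (grid_conv N s u k * u k)" "0 \<le> dc * (grid_conv N r v k * u k)"
      using d nn parts_nn by auto
    ultimately have "d * u k = 0" "ds * (grid_conv N s u k * u k) = 0" "dc * (grid_conv N r v k * u k) = 0"
      by linarith+
    then show ?thesis
      using d grid_conv_mult_eq_0[OF N per(3,1) nn(4,1), of k "u k" j]
        grid_conv_mult_eq_0[OF N per(4,2) nn(5,2), of k "u k" j] by auto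
  qed
  have zero: "\<mu> (i + 1) * u (i + 1) = 0" "\<mu> (i - 1) * u (i - 1) = 0" if "u i = 0" for i
    using scheme_eq_zero(2,3)[OF N dt eq nn(1,3) \<mu>_nn that] .
  show "r j * (u (i + 1) * v (i + 1 - j)) = 0 \<and> r j * (u (i - 1) * v (i - 1 - j)) = 0" if "u i = 0" for i j
    using split[OF zero(1)[OF that]] split[OF zero(2)[OF that]] by blast
  define A where "A = (\<Sum>i\<in>{0..<int N}. (u (i + 1) - u i) * (ln (u (i + 1)) - ln (u i)))"
  \<comment> \<open>If a neighbour of a zero is positive, then \<open>d = 0\<close> and the edge does not count.\<close>
  have A: "4 * d * (dx N * h1_seminorm_sq N (\<lambda>i. sqrt (u i))) \<le> d * A"
  proof -
    have "4 * d * (sqrt (u (i + 1)) - sqrt (u i))\<^sup>2 \<le> d * ((u (i + 1) - u i) * (ln (u (i + 1)) - ln (u i)))" for i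
    proof (cases "u (i + 1) = 0 \<or> u i = 0")
      case True
      then have "d = 0 \<or> u (i + 1) = 0 \<and> u i = 0"
        using split[OF zero(1), of i] split[OF zero(2), of "i + 1"] by auto
      then show ?thesis by auto
    next
      case False
      then have "0 < u (i + 1)" "0 < u i"
        using nn(1)[of i] nn(1)[of "i + 1"] by linarith+
      from mult_left_mono[OF sqrt_diff_sq_le_ln_diff[OF this] d(1)] show ?thesis
        by (simp add: mult.commute mult.left_commute)
    qed
    then show ?thesis
      unfolding h1_seminorm_sq_eq[OF N] A_def sum_distrib_left by (intro sum_mono)
  qed
  have S: "2 * ds * pair_dissipation N s u u \<le> ds * log_pairing N s u u"
  proof (cases "ds = 0")
    case False
    have z: "s j * (u (i + 1) * u (i + 1 - j)) = 0 \<and> s j * (u (i - 1) * u (i - 1 - j)) = 0" if "u i = 0" for i j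
      using split[OF zero(1)[OF that]] split[OF zero(2)[OF that]] False by blast
    have "4 * pair_dissipation N s u u \<le> log_pairing N s u u + log_pairing N (\<lambda>j. s (- j)) u u"
      by (rule pair_dissipation_le_log_pairing[OF N per(1,1,3) nn(1,1,4)]) (use z s_sym in auto)
    then have "2 * pair_dissipation N s u u \<le> log_pairing N s u u"
      by (simp add: s_sym)
    from mult_left_mono[OF this d(2)] show ?thesis by simp
  qed simp
  have "(\<Sum>i\<in>{0..<int N}. (\<mu> (i + 1) * u (i + 1) - \<mu> i * u i) * (ln (u (i + 1)) - ln (u i)))
     = d * A + ds * (dx N * log_pairing N s u u) + dc * (dx N * log_pairing N r u v)"
    unfolding A_def grid_conv_flux[OF N per(3,1), symmetric] grid_conv_flux[OF N per(4,2), symmetric]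
      sum_distrib_left sum.distrib[symmetric]
    by (intro sum.cong refl) (simp add: \<mu>_def algebra_simps)
  also have "\<dots> \<ge> 4 * d * (dx N * h1_seminorm_sq N (\<lambda>i. sqrt (u i))) + dx N * (2 * ds * pair_dissipation N s u u)
       + dc * (dx N * log_pairing N r u v)"
    using A mult_left_mono[OF S less_imp_le[OF dx]] by (simp add: mult.left_commute)
  finally have "dt / dx N * (1 / dc) * (4 * d * (dx N * h1_seminorm_sq N (\<lambda>i. sqrt (u i)))
        + dx N * (2 * ds * pair_dissipation N s u u) + dc * (dx N * log_pairing N r u v))
     \<le> dt / dx N * (1 / dc) * (\<Sum>i\<in>{0..<int N}. (\<mu> (i + 1) * u (i + 1) - \<mu> i * u i) * (ln (u (i + 1)) - ln (u i)))"
    using dt dx d by (intro mult_left_mono) auto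
  moreover have "dt / dx N * (1 / dc) * (4 * d * (dx N * h1_seminorm_sq N (\<lambda>i. sqrt (u i)))
        + dx N * (2 * ds * pair_dissipation N s u u) + dc * (dx N * log_pairing N r u v))
     = dt * (4 * (d / dc) * h1_seminorm_sq N (\<lambda>i. sqrt (u i)) + 2 * (ds / dc) * pair_dissipation N s u u
            + log_pairing N r u v)"
    using dx d(3) by (simp add: field_simps)
  ultimately show ?entropy
    using scheme_eq_entropy[OF N dt d(3) eq nn(1,3) \<mu>_nn per(1) \<mu>_per] by linarith
qed

section \<open>The coupled system\<close>

text \<open>One time step, with arbitrary periodic grid kernels in the role of the cell averages.\<close>

lemma scheme_step:
  fixes N :: nat and dt d1 d2 d11 d12 d21 d22 :: real and s1 s2 r p1 p2 :: "int \<Rightarrow> real"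
  assumes N: "N \<ge> 1" and dt: "dt > 0"
    and d: "d1 \<ge> 0" "d2 \<ge> 0" "d11 \<ge> 0" "d22 \<ge> 0" "d12 > 0" "d21 > 0"
    and s1: "grid_periodic N s1" "\<And>i. 0 \<le> s1 i" "\<And>i. s1 (- i) = s1 i"
    and s2: "grid_periodic N s2" "\<And>i. 0 \<le> s2 i" "\<And>i. s2 (- i) = s2 i"
    and r: "grid_periodic N r" "\<And>i. 0 \<le> r i"
    and p1: "grid_periodic N p1" "\<And>i. 0 \<le> p1 i" and p2: "grid_periodic N p2" "\<And>i. 0 \<le> p2 i"
  shows "\<exists>u v. grid_periodic N u \<and> grid_periodic N v \<and> (\<forall>i. 0 \<le> u i \<and> 0 \<le> v i) \<and>
     scheme_eq N dt (\<lambda>i. d1 + d11 * grid_conv N s1 u i + d12 * grid_conv N r v i) p1 u \<and>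
     scheme_eq N dt (\<lambda>i. d2 + d22 * grid_conv N s2 v i + d21 * grid_conv N (\<lambda>j. r (- j)) u i) p2 v \<and>
     (\<Sum>i\<in>{0..<int N}. u i) = (\<Sum>i\<in>{0..<int N}. p1 i) \<and>
     (\<Sum>i\<in>{0..<int N}. v i) = (\<Sum>i\<in>{0..<int N}. p2 i) \<and>
     entropy N d12 d21 u v + dt *
       (2 * (d11 / d12) * pair_dissipation N s1 u u + 2 * (d22 / d21) * pair_dissipation N s2 v v
        + 4 * (d1 / d12) * h1_seminorm_sq N (\<lambda>i. sqrt (u i))
        + 4 * (d2 / d21) * h1_seminorm_sq N (\<lambda>i. sqrt (v i)) + 4 * pair_dissipation N r u v)
       \<le> entropy N d12 d21 p1 p2 \<and>
     (d1 > 0 \<and> 0 < (\<Sum>i\<in>{0..<int N}. u i) \<longrightarrow> (\<forall>i. 0 < u i)) \<and>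
     (d2 > 0 \<and> 0 < (\<Sum>i\<in>{0..<int N}. v i) \<longrightarrow> (\<forall>i. 0 < v i))"
proof -
  define r' where "r' j = r (- j)" for j
  have r': "grid_periodic N r'" "\<And>i. 0 \<le> r' i"
  proof -
    have "r (- (i + int N)) = r (- i)" for i
      using grid_periodic_add[OF r(1), of "- (i + int N)"] by simp
    then show "grid_periodic N r'" by (simp add: grid_periodic_def r'_def)
    show "0 \<le> r' i" for i using r(2) by (simp add: r'_def)
  qed
  \<comment> \<open>Species 0 is \<open>u\<close> and species 1 is \<open>v\<close>.\<close>
  define m :: "nat \<Rightarrow> (nat \<Rightarrow> int \<Rightarrow> real) \<Rightarrow> int \<Rightarrow> real" where
    "m s u = (if s = 0 then (\<lambda>i. d1 + d11 * grid_conv N s1 (u 0) i + d12 * grid_conv N r (u 1) i)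
                else (\<lambda>i. d2 + d22 * grid_conv N s2 (u 1) i + d21 * grid_conv N r' (u 0) i))" for s u
  have per: "grid_periodic N (grid_conv N s1 u)" "grid_periodic N (grid_conv N s2 u)"
    "grid_periodic N (grid_conv N r u)" "grid_periodic N (grid_conv N r' u)" for u
    by (intro grid_conv_periodic s1(1) s2(1) r(1) r'(1))+
  have coord: "continuous_on UNIV (\<lambda>u :: nat \<Rightarrow> int \<Rightarrow> real. u s i)" for s i
    by (rule continuous_on_product_then_coordinatewise[OF continuous_on_product_coordinates])
  have "\<exists>w. (\<forall>s. grid_periodic N (w s)) \<and> (\<forall>s i. 0 \<le> w s i) \<and>
           (\<forall>s<2. scheme_eq N dt (m s w) (if s = 0 then p1 else p2) (w s))"
  proof (rule implicit_step_exists[OF N _ dt])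
    show "continuous_on UNIV (\<lambda>u. m s u i)" for s i
      unfolding m_def grid_conv_def by (cases "s = 0") (auto intro!: continuous_intros coord)
    show "0 \<le> m s u i" if "\<And>t i. 0 \<le> u t i" for s i u
      using d s1(2) s2(2) r(2) r'(2) that by (simp add: m_def grid_conv_nonneg)
    show "grid_periodic N (m s u)" if "\<And>t. grid_periodic N (u t)" for s u
      using per by (simp add: m_def grid_periodic_def)
  qed (use p1 p2 in auto)
  then obtain w where w: "\<And>s. grid_periodic N (w s)" "\<And>s i. 0 \<le> w s i"
    and eq: "\<And>s. s < 2 \<Longrightarrow> scheme_eq N dt (m s w) (if s = 0 then p1 else p2) (w s)"
    by blast
  define u v where "u = w 0" and "v = w 1"
  have u: "grid_periodic N u" "0 \<le> u i" and v: "grid_periodic N v" "0 \<le> v i" for i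
    using w by (simp_all add: u_def v_def)
  define \<mu> \<nu> where "\<mu> = (\<lambda>i. d1 + d11 * grid_conv N s1 u i + d12 * grid_conv N r v i)"
    and "\<nu> = (\<lambda>i. d2 + d22 * grid_conv N s2 v i + d21 * grid_conv N r' u i)"
  have eq1: "scheme_eq N dt \<mu> p1 u" and eq2: "scheme_eq N dt \<nu> p2 v"
    using eq[of 0] eq[of 1] by (simp_all add: m_def u_def v_def \<mu>_def \<nu>_def)
  have \<mu>_per: "grid_periodic N \<mu>" "grid_periodic N \<nu>"
    using per by (simp_all add: \<mu>_def \<nu>_def grid_periodic_def)
  have \<mu>_ge: "d1 \<le> \<mu> i" "d2 \<le> \<nu> i" for i
    using d s1(2) s2(2) r(2) r'(2) u(2) v(2) by (simp_all add: \<mu>_def \<nu>_def grid_conv_nonneg)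
  note ent1 = one_species_entropy[OF N dt d(1,3,5) eq1[unfolded \<mu>_def] u(1) v(1) s1(1) r(1) u(2) v(2) p1(2) s1(2) r(2) s1(3)]
  note ent2 = one_species_entropy[OF N dt d(2,4,6) eq2[unfolded \<nu>_def] v(1) u(1) s2(1) r'(1) v(2) u(2) p2(2) s2(2) r'(2) s2(3)]
  have cross: "4 * pair_dissipation N r u v \<le> log_pairing N r u v + log_pairing N r' v u"
    using pair_dissipation_le_log_pairing[OF N u(1) v(1) r(1) u(2) v(2) r(2) ent1(2)] ent2(2)
    unfolding r'_def by blast
  have "entropy N d12 d21 u v + dt *
       (2 * (d11 / d12) * pair_dissipation N s1 u u + 2 * (d22 / d21) * pair_dissipation N s2 v v
        + 4 * (d1 / d12) * h1_seminorm_sq N (\<lambda>i. sqrt (u i))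
        + 4 * (d2 / d21) * h1_seminorm_sq N (\<lambda>i. sqrt (v i)) + 4 * pair_dissipation N r u v)
       \<le> entropy N d12 d21 p1 p2"
    using ent1(1) ent2(1) mult_left_mono[OF cross less_imp_le[OF dt]]
    unfolding entropy_def distrib_left by linarith
  moreover have "(\<Sum>i\<in>{0..<int N}. u i) = (\<Sum>i\<in>{0..<int N}. p1 i)"
    "(\<Sum>i\<in>{0..<int N}. v i) = (\<Sum>i\<in>{0..<int N}. p2 i)"
    by (rule scheme_eq_mass[OF N dt eq1 u(1) \<mu>_per(1)], rule scheme_eq_mass[OF N dt eq2 v(1) \<mu>_per(2)])
  moreover have "0 < u i" if "d1 > 0" "0 < (\<Sum>i\<in>{0..<int N}. u i)" for i
    by (rule scheme_eq_pos[OF N dt eq1 u(2) p1(2) less_le_trans[OF that(1) \<mu>_ge(1)] that(2)])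
  moreover have "0 < v i" if "d2 > 0" "0 < (\<Sum>i\<in>{0..<int N}. v i)" for i
    by (rule scheme_eq_pos[OF N dt eq2 v(2) p2(2) less_le_trans[OF that(1) \<mu>_ge(2)] that(2)])
  ultimately show ?thesis
    using u v eq1 eq2 unfolding \<mu>_def \<nu>_def r'_def by - (rule exI[where x = u], rule exI[where x = v], simp)
qed

text \<open>
  On the grid the almost-everywhere relations between the kernels become exact: \<open>\<rho>\<close> and \<open>\<rho>1\<close> have the
  same cell averages, those of \<open>\<rho>2\<close> are their reflection, and the averages of \<open>\<sigma>1\<close> and \<open>\<sigma>2\<close> are even.
  A choice of one solution per time step is then iterated.
\<close>

theorem theorem1:
  fixes N NT :: nat
    and T d1 d2 d11 d12 d21 d22 :: real
    and \<rho> \<rho>1 \<rho>2 \<sigma>1 \<sigma>2 u01 u02 :: "real \<Rightarrow> real"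
  assumes "N \<ge> 1" and "NT \<ge> 1" and "T > 0"
    and "d1 \<ge> 0" and "d2 \<ge> 0" and "d11 \<ge> 0" and "d22 \<ge> 0" and "d12 > 0" and "d21 > 0"
    and "Linf_torus \<rho>1" and "Linf_torus \<rho>2" and "Linf_torus \<sigma>1" and "Linf_torus \<sigma>2"
    and "AE x in lebesgue. 0 \<le> \<rho>1 x" and "AE x in lebesgue. 0 \<le> \<rho>2 x"
    and "AE x in lebesgue. 0 \<le> \<sigma>1 x" and "AE x in lebesgue. 0 \<le> \<sigma>2 x"
    and "AE x in lebesgue. \<rho>1 x = \<rho> x" and "AE x in lebesgue. \<rho>2 (- x) = \<rho> x"
    and "AE x in lebesgue. \<sigma>1 x = \<sigma>1 (- x)" and "AE x in lebesgue. \<sigma>2 x = \<sigma>2 (- x)"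
    and "L1_torus u01" and "L1_torus u02"
    and "AE x in lebesgue. 0 \<le> u01 x" and "AE x in lebesgue. 0 \<le> u02 x"
    and "L1_torus (\<lambda>x. entropy_density d12 (u01 x))"
    and "L1_torus (\<lambda>x. entropy_density d21 (u02 x))"
  shows "\<exists>u1 u2 :: nat \<Rightarrow> int \<Rightarrow> real.
      u1 0 = cell_avg N u01 \<and> u2 0 = cell_avg N u02 \<and>
      (\<forall>k\<in>{1..NT}.
         grid_periodic N (u1 k) \<and> grid_periodic N (u2 k) \<and>
         (\<forall>i. 0 \<le> u1 k i \<and> 0 \<le> u2 k i) \<and>
         scheme_eq N (T / real NT) (diffusivity N d1 d11 \<sigma>1 d12 \<rho>1 (u1 k) (u2 k))
           (u1 (k - 1)) (u1 k) \<and>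
         scheme_eq N (T / real NT) (diffusivity N d2 d22 \<sigma>2 d21 \<rho>2 (u2 k) (u1 k))
           (u2 (k - 1)) (u2 k)) \<and>
      (\<forall>k\<in>{0..NT}.
         (\<Sum>i\<in>{0..<int N}. dx N * u1 k i) = torus_integral u01 \<and>
         (\<Sum>i\<in>{0..<int N}. dx N * u2 k i) = torus_integral u02) \<and>
      (\<forall>k\<in>{1..NT}.
         entropy N d12 d21 (u1 k) (u2 k)
           + T / real NT * dissipation N d1 d2 d11 d12 d21 d22 \<sigma>1 \<sigma>2 \<rho> (u1 k) (u2 k)
         \<le> entropy N d12 d21 (u1 (k - 1)) (u2 (k - 1))) \<and>
      (d1 > 0 \<and> torus_integral u01 > 0 \<longrightarrow> (\<forall>k\<in>{1..NT}. \<forall>i. 0 < u1 k i)) \<and>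
      (d2 > 0 \<and> torus_integral u02 > 0 \<longrightarrow> (\<forall>k\<in>{1..NT}. \<forall>i. 0 < u2 k i))"
proof -
  define dt where "dt = T / real NT"
  define s1 s2 r where "s1 = cell_avg N \<sigma>1" and "s2 = cell_avg N \<sigma>2" and "r = cell_avg N \<rho>1"
  note N = \<open>N \<ge> 1\<close>
  have dt: "dt > 0" using assms by (simp add: dt_def)
  have dx: "dx N > 0" using N by (simp add: dx_def)
  have meas: "torus_measurable \<rho>1" "torus_measurable \<rho>2" "torus_measurable \<sigma>1" "torus_measurable \<sigma>2"
    "torus_measurable u01" "torus_measurable u02"
    using assms by (auto simp: Linf_torus_def L1_torus_def)
  have r_\<rho>: "cell_avg N \<rho> = r"
    unfolding r_def using cell_avg_cong_AE[OF torus_measurable_borel[OF meas(1)]] assms by metis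
  have reflected: "cell_avg N (\<lambda>x. \<rho>2 (- x)) = cell_avg N \<rho>"
    "cell_avg N (\<lambda>x. \<sigma>1 (- x)) = s1" "cell_avg N (\<lambda>x. \<sigma>2 (- x)) = s2"
    unfolding s1_def s2_def
    by (rule cell_avg_cong_AE cell_avg_cong_AE[symmetric],
        use assms meas in \<open>auto intro: torus_measurable_borel torus_measurable_reflect_borel\<close>)+
  have r2: "cell_avg N \<rho>2 = (\<lambda>j. r (- j))"
    using cell_avg_reflect[of N \<rho>2 "- j" for j] by (auto simp: reflected r_\<rho>)
  have s1: "grid_periodic N s1" "0 \<le> s1 i" "s1 (- i) = s1 i"
    and s2: "grid_periodic N s2" "0 \<le> s2 i" "s2 (- i) = s2 i"
    and r: "grid_periodic N r" "0 \<le> r i" for i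
    using assms cell_avg_periodic[OF N] meas cell_avg_reflect[of N] reflected
    by (auto simp: s1_def s2_def r_def intro: cell_avg_nonneg)
  define good where "good p \<longleftrightarrow> grid_periodic N (fst p) \<and> grid_periodic N (snd p) \<and> (\<forall>i. 0 \<le> fst p i \<and> 0 \<le> snd p i)"
    for p :: "(int \<Rightarrow> real) \<times> (int \<Rightarrow> real)"
  define step where "step p q \<longleftrightarrow> good q \<and>
     scheme_eq N dt (diffusivity N d1 d11 \<sigma>1 d12 \<rho>1 (fst q) (snd q)) (fst p) (fst q) \<and>
     scheme_eq N dt (diffusivity N d2 d22 \<sigma>2 d21 \<rho>2 (snd q) (fst q)) (snd p) (snd q) \<and>
     (\<Sum>i\<in>{0..<int N}. fst q i) = (\<Sum>i\<in>{0..<int N}. fst p i) \<and>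
     (\<Sum>i\<in>{0..<int N}. snd q i) = (\<Sum>i\<in>{0..<int N}. snd p i) \<and>
     entropy N d12 d21 (fst q) (snd q)
        + dt * dissipation N d1 d2 d11 d12 d21 d22 \<sigma>1 \<sigma>2 \<rho> (fst q) (snd q)
        \<le> entropy N d12 d21 (fst p) (snd p) \<and>
     (d1 > 0 \<and> 0 < (\<Sum>i\<in>{0..<int N}. fst q i) \<longrightarrow> (\<forall>i. 0 < fst q i)) \<and>
     (d2 > 0 \<and> 0 < (\<Sum>i\<in>{0..<int N}. snd q i) \<longrightarrow> (\<forall>i. 0 < snd q i))"
    for p q :: "(int \<Rightarrow> real) \<times> (int \<Rightarrow> real)"
  have "\<exists>q. step p q" if "good p" for p
  proof -
    have p: "grid_periodic N (fst p)" "0 \<le> fst p i" "grid_periodic N (snd p)" "0 \<le> snd p i" for i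
      using that by (auto simp: good_def)
    obtain u v where "step p (u, v)"
      using scheme_step[OF N dt assms(4-9) s1 s2 r p]
      unfolding step_def good_def diffusivity_def dissipation_def r_\<rho> r2
      unfolding s1_def[symmetric] s2_def[symmetric] r_def[symmetric] fst_conv snd_conv by blast
    then show ?thesis by blast
  qed
  then obtain next_step where next_step: "\<And>p. good p \<Longrightarrow> step p (next_step p)"
    by metis
  define U where "U k = (next_step ^^ k) (cell_avg N u01, cell_avg N u02)" for k
  have U0: "U 0 = (cell_avg N u01, cell_avg N u02)" by (simp add: U_def)
  have goodU: "good (U k)" for k
  proof (induction k)
    case 0
    show ?case
      using assms meas cell_avg_periodic[OF N] by (auto simp: U0 good_def intro: cell_avg_nonneg)
  next
    case (Suc k)
    then show ?case using next_step[of "U k"] by (simp add: U_def step_def)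
  qed
  have stepU: "step (U (k - 1)) (U k)" if "k \<in> {1..NT}" for k
    using next_step[OF goodU[of "k - 1"]] that by (cases k) (auto simp: U_def)
  have mass: "(\<Sum>i\<in>{0..<int N}. dx N * fst (U k) i) = torus_integral u01 \<and>
         (\<Sum>i\<in>{0..<int N}. dx N * snd (U k) i) = torus_integral u02" for k
  proof (induction k)
    case 0
    show ?case using sum_cell_avg[OF N] assms by (simp add: U0)
  next
    case (Suc k)
    have "step (U k) (U (Suc k))"
      using next_step[OF goodU[of k]] by (simp add: U_def)
    then show ?case
      using Suc by (simp add: step_def flip: sum_distrib_left)
  qed
  have pos: "0 < (\<Sum>i\<in>{0..<int N}. fst (U k) i)" if "torus_integral u01 > 0" for k
  proof -
    have "dx N * (\<Sum>i\<in>{0..<int N}. fst (U k) i) = torus_integral u01"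
      using mass[of k] by (simp add: sum_distrib_left)
    then show ?thesis using that dx by (metis zero_less_mult_pos)
  qed
  have pos': "0 < (\<Sum>i\<in>{0..<int N}. snd (U k) i)" if "torus_integral u02 > 0" for k
  proof -
    have "dx N * (\<Sum>i\<in>{0..<int N}. snd (U k) i) = torus_integral u02"
      using mass[of k] by (simp add: sum_distrib_left)
    then show ?thesis using that dx by (metis zero_less_mult_pos)
  qed
  show ?thesis
  proof (rule exI[of _ "\<lambda>k. fst (U k)"], rule exI[of _ "\<lambda>k. snd (U k)"], intro conjI)
    show "fst (U 0) = cell_avg N u01" "snd (U 0) = cell_avg N u02"
      by (simp_all add: U0)
    show "\<forall>k\<in>{1..NT}. grid_periodic N (fst (U k)) \<and> grid_periodic N (snd (U k)) \<and>
         (\<forall>i. 0 \<le> fst (U k) i \<and> 0 \<le> snd (U k) i) \<and>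
         scheme_eq N (T / real NT) (diffusivity N d1 d11 \<sigma>1 d12 \<rho>1 (fst (U k)) (snd (U k)))
           (fst (U (k - 1))) (fst (U k)) \<and>
         scheme_eq N (T / real NT) (diffusivity N d2 d22 \<sigma>2 d21 \<rho>2 (snd (U k)) (fst (U k)))
           (snd (U (k - 1))) (snd (U k))"
      using stepU unfolding step_def good_def dt_def by blast
    show "\<forall>k\<in>{0..NT}. (\<Sum>i\<in>{0..<int N}. dx N * fst (U k) i) = torus_integral u01 \<and>
         (\<Sum>i\<in>{0..<int N}. dx N * snd (U k) i) = torus_integral u02"
      using mass by blast
    show "\<forall>k\<in>{1..NT}. entropy N d12 d21 (fst (U k)) (snd (U k))
           + T / real NT * dissipation N d1 d2 d11 d12 d21 d22 \<sigma>1 \<sigma>2 \<rho> (fst (U k)) (snd (U k))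
         \<le> entropy N d12 d21 (fst (U (k - 1))) (snd (U (k - 1)))"
      using stepU unfolding step_def dt_def by blast
    show "d1 > 0 \<and> torus_integral u01 > 0 \<longrightarrow> (\<forall>k\<in>{1..NT}. \<forall>i. 0 < fst (U k) i)"
      using stepU pos unfolding step_def by blast
    show "d2 > 0 \<and> torus_integral u02 > 0 \<longrightarrow> (\<forall>k\<in>{1..NT}. \<forall>i. 0 < snd (U k) i)"
      using stepU pos' unfolding step_def by blast
  qed
qed

end
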